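(* Let $\mathcal{M}\to\mathcal{B}$ be a twisted principal $\mathbb{R}^N$-bundle over a compact base, and let $(g(t),A(t),G(t))$ be a family of locally $\mathbb{R}^N$-invariant metrics on $\mathcal{M}$ solving the locally $\mathbb{R}^N$-invariant Ricci flow. Let $\mathcal{S}_N=\mathrm{SL}(N,\mathbb{R})/\mathrm{SO}(N)$ be the space of inner products on $\mathbb{R}^N$ with fixed volume, with the Riemannian metric $\overline{g}_G(X,Y)=\mathrm{tr}(G^{-1}XG^{-1}Y)$. Then the evolution equation for $G$ is a modified harmonic map flow for $G:\mathcal{B}\to\mathcal{S}_N$; more precisely, $$\frac{\partial}{\partial t}G_{ij}=(\tau_{g(t),\overline{g}}\,G)_{ij}-\frac12\,g^{\alpha\gamma}g^{\beta\delta}G_{ik}G_{j\ell}(dA)^k_{\alpha\beta}(dA)^\ell_{\gamma\delta},$$ where $\tau_{g,\overline{g}}G$ is the tension field of $G:(\mathcal{B},g)\to(\mathcal{S}_N,\overline{g})$.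
   Context: **Locally $\mathbb{R}^N$-invariant metrics.** A twisted principal $\mathbb{R}^N$-bundle $\mathcal{M}\to\mathcal{B}$ is a fiber bundle on which a flat $\mathbb{R}^N$-vector bundle over $\mathcal{B}$ acts fiberwise, freely and transitively on the fibers. Over small open sets of $\mathcal{B}$ with coordinates $b^\alpha$, and with fiber coordinates $x^i$ coming from a flat local frame, a metric invariant under this action has the form $$g_{\alpha\beta}\,db^\alpha db^\beta+G_{ij}(dx^i+A^i_\alpha db^\alpha)(dx^j+A^j_\beta db^\beta),$$ with $g,A,G$ depending only on $b$; it is denoted $(g,A,G)$, where $g$ is a metric on the base, $A$ is an $\mathbb{R}^N$-valued $1$-form corresponding to a connection, and $G$ is an inner product on the fibers. Greek indices refer to the base, Latin indices to the fiber. $G$ is (locally) regarded as a map $G:\mathcal{B}\to\mathcal{S}_N$. **The flow.** The locally $\mathbb{R}^N$-invariant Ricci flow is the system $$\partial_t g_{\alpha\beta}=-2R_{\alpha\beta}+\tfrac12G^{ik}G^{j\ell}\nabla_\alpha G_{ij}\nabla_\beta G_{k\ell}+g^{\gamma\delta}G_{ij}(dA)^i_{\alpha\gamma}(dA)^j_{\beta\delta},$$ $$\partial_tA^i_\alpha=-(\delta dA)^i_\alpha+G^{ij}\nabla^\beta G_{jk}(dA)^k_{\beta\alpha},$$ $$\partial_tG_{ij}=\Delta G_{ij}-G^{k\ell}\nabla_\alpha G_{ik}\nabla^\alpha G_{\ell j}-\tfrac12g^{\alpha\gamma}g^{\beta\delta}G_{ik}G_{j\ell}(dA)^k_{\alpha\beta}(dA)^\ell_{\gamma\delta}.$$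 Here $R_{\alpha\beta}$ is the Ricci tensor of $g$, $\nabla_\alpha G_{ij}$ is the derivative of the function $G_{ij}$ (flat local frame), $\Delta G_{ij}=g^{\alpha\beta}\nabla_\alpha\nabla_\beta G_{ij}$ is the Laplacian of $g$ applied componentwise, and $G^{ij}$ is the inverse matrix of $G_{ij}$. **Target.** $T_G\mathcal{S}_N$ consists of the symmetric bilinear forms $X$ on $\mathbb{R}^N$ that are trace-free with respect to $G$ ($G^{ij}X_{ij}=0$), and $\overline{g}_G(X,Y)=G^{ij}X_{jk}G^{k\ell}Y_{\ell i}$. Components $(\cdot)_{ij}$ of tangent vectors to $\mathcal{S}_N$ are their matrix entries. The tension field of a map $\phi:(\mathcal{B},g)\to(\mathcal{N},h)$ is $\tau_{g,h}\phi=\mathrm{tr}_g\nabla^2\phi$, with $\nabla$ induced by the Levi-Civita connections of $g$ and $h$. *)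

theory Defs
  imports "HOL-Analysis.Analysis"
begin

section \<open>Smooth maps and smooth manifolds\<close>

text \<open>Meant for open sets only. In finite dimension, being of class \<open>C\<^sup>k\<^sup>+\<^sup>1\<close> on an open set
  amounts to differentiability with all directional derivatives of class \<open>C\<^sup>k\<close>.\<close>

primrec Ck_on :: "nat \<Rightarrow> 'v set \<Rightarrow> ('v::euclidean_space \<Rightarrow> 'w::real_normed_vector) \<Rightarrow> bool" where
  "Ck_on 0 S f \<longleftrightarrow> continuous_on S f"
| "Ck_on (Suc k) S f \<longleftrightarrow>
     (\<forall>x\<in>S. f differentiable (at x)) \<and> (\<forall>v. Ck_on k S (\<lambda>x. frechet_derivative f (at x) v))"

definition smooth_on :: "'v set \<Rightarrow> ('v::euclidean_space \<Rightarrow> 'w::real_normed_vector) \<Rightarrow> bool" where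
  "smooth_on S f \<longleftrightarrow> (\<forall>k. Ck_on k S f)"

type_synonym ('a, 'v) chart = "'a set \<times> ('a \<Rightarrow> 'v)"

definition is_chart :: "('a::topological_space, 'v::euclidean_space) chart \<Rightarrow> bool" where
  "is_chart = (\<lambda>(U, \<phi>). open U \<and> open (\<phi> ` U) \<and> homeomorphism U (\<phi> ` U) \<phi> (inv_into U \<phi>))"

definition compatible :: "('a, 'v::euclidean_space) chart \<Rightarrow> ('a, 'v) chart \<Rightarrow> bool" where
  "compatible = (\<lambda>(U, \<phi>) (V, \<psi>).
     smooth_on (\<phi> ` (U \<inter> V)) (\<psi> \<circ> inv_into U \<phi>) \<and> smooth_on (\<psi> ` (U \<inter> V)) (\<phi> \<circ> inv_into V \<psi>))"

definition smooth_atlas :: "('a::topological_space, 'v::euclidean_space) chart set \<Rightarrow> bool" where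
  "smooth_atlas \<A> \<longleftrightarrow>
     (\<forall>c\<in>\<A>. is_chart c) \<and> (\<Union>c\<in>\<A>. fst c) = UNIV \<and> (\<forall>c\<in>\<A>. \<forall>d\<in>\<A>. compatible c d)"

text \<open>The maximal atlas determined by \<open>\<A>\<close>.\<close>

definition charts :: "('a::topological_space, 'v::euclidean_space) chart set \<Rightarrow> ('a, 'v) chart set" where
  "charts \<A> = {c. is_chart c \<and> (\<forall>d\<in>\<A>. compatible c d)}"

section \<open>Twisted principal bundles\<close>

text \<open>The data consist of a base \<open>'b\<close> of dimension \<open>CARD('n)\<close>, a total space \<open>'m\<close>, and a flat
  vector bundle \<open>'e\<close> of rank \<open>N = CARD('r)\<close> over the base, acting on \<open>'m\<close>. A pair \<open>(U, \<psi>)\<close> in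
  \<open>frames\<close> is a flat local frame over \<open>U\<close>, given by the map \<open>\<psi>\<close> that sends an element of a fibre
  of \<open>'e\<close> over \<open>U\<close> to its components. These maps also carry the vector space structure of the
  fibres. Only the values \<open>act e m\<close> with \<open>e\<close> and \<open>m\<close> over the same base point are relevant.\<close>

record ('b, 'm, 'e, 'n, 'r) tp_bundle =
  base_atlas :: "('b, real ^ 'n::finite) chart set"
  total_atlas :: "('m, (real ^ 'n) \<times> (real ^ 'r::finite)) chart set"
  proj :: "'m \<Rightarrow> 'b"
  vproj :: "'e \<Rightarrow> 'b"
  frames :: "('b set \<times> ('e \<Rightarrow> real ^ 'r)) set"
  act :: "'e \<Rightarrow> 'm \<Rightarrow> 'm"

definition vtrivialization ::
  "('b::topological_space, 'm, 'e::topological_space, 'n::finite, 'r::finite) tp_bundle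
     \<Rightarrow> 'b set \<times> ('e \<Rightarrow> real ^ 'r) \<Rightarrow> bool" where
  "vtrivialization B = (\<lambda>(U, \<psi>). open U \<and>
     (\<exists>k. homeomorphism (vproj B -` U) (U \<times> UNIV) (\<lambda>e. (vproj B e, \<psi> e)) k))"

definition flat_transition ::
  "('b::topological_space, 'm, 'e, 'n::finite, 'r::finite) tp_bundle
     \<Rightarrow> 'b set \<times> ('e \<Rightarrow> real ^ 'r) \<Rightarrow> 'b set \<times> ('e \<Rightarrow> real ^ 'r) \<Rightarrow> bool" where
  "flat_transition B = (\<lambda>(U, \<psi>) (V, \<psi>').
     \<forall>b\<in>U \<inter> V. \<exists>W (P :: real ^ 'r ^ 'r). open W \<and> b \<in> W \<and> W \<subseteq> U \<inter> V \<and> invertible P \<and>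
       (\<forall>e. vproj B e \<in> W \<longrightarrow> \<psi>' e = P *v \<psi> e))"

definition flat_vector_bundle ::
  "('b::topological_space, 'm, 'e::topological_space, 'n::finite, 'r::finite) tp_bundle \<Rightarrow> bool" where
  "flat_vector_bundle B \<longleftrightarrow>
     (\<forall>f\<in>frames B. vtrivialization B f) \<and> (\<Union>f\<in>frames B. fst f) = UNIV \<and>
     (\<forall>f\<in>frames B. \<forall>f'\<in>frames B. flat_transition B f f')"

definition flat_frames ::
  "('b::topological_space, 'm, 'e::topological_space, 'n::finite, 'r::finite) tp_bundle
     \<Rightarrow> ('b set \<times> ('e \<Rightarrow> real ^ 'r)) set" where
  "flat_frames B = {f. vtrivialization B f \<and> (\<forall>f'\<in>frames B. flat_transition B f f')}"

text \<open>A fibre chart \<open>(U, \<beta>, \<xi>)\<close> consists of base coordinates \<open>\<beta>\<close> on \<open>U\<close> and a smooth local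
  trivialization over \<open>U\<close> with fibre component \<open>\<xi>\<close>.\<close>

type_synonym ('b, 'm, 'n, 'r) fchart = "'b set \<times> ('b \<Rightarrow> real ^ 'n) \<times> ('m \<Rightarrow> real ^ 'r)"

definition total_chart ::
  "('b, 'm, 'e, 'n::finite, 'r::finite) tp_bundle \<Rightarrow> ('b, 'm, 'n, 'r) fchart
     \<Rightarrow> ('m, (real ^ 'n) \<times> (real ^ 'r)) chart" where
  "total_chart B = (\<lambda>(U, \<beta>, \<xi>). (proj B -` U, \<lambda>m. (\<beta> (proj B m), \<xi> m)))"

definition fiber_charts ::
  "('b::topological_space, 'm::topological_space, 'e, 'n::finite, 'r::finite) tp_bundle
     \<Rightarrow> ('b, 'm, 'n, 'r) fchart set" where
  "fiber_charts B = {(U, \<beta>, \<xi>).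
     (U, \<beta>) \<in> charts (base_atlas B) \<and> total_chart B (U, \<beta>, \<xi>) \<in> charts (total_atlas B) \<and>
     (\<lambda>m. (\<beta> (proj B m), \<xi> m)) ` (proj B -` U) = (\<beta> ` U) \<times> UNIV}"

definition smooth_action ::
  "('b::topological_space, 'm::topological_space, 'e::topological_space, 'n::finite, 'r::finite) tp_bundle
     \<Rightarrow> bool" where
  "smooth_action B \<longleftrightarrow>
     (\<forall>(U, \<beta>, \<xi>)\<in>fiber_charts B. \<forall>\<psi>. (U, \<psi>) \<in> flat_frames B \<longrightarrow>
        smooth_on ((\<beta> ` U) \<times> UNIV \<times> UNIV)
          (\<lambda>(p, v, x). \<xi> (act B
             (inv_into (vproj B -` U) (\<lambda>e. (vproj B e, \<psi> e)) (inv_into U \<beta> p, v))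
             (inv_into (proj B -` U) (\<lambda>m. (\<beta> (proj B m), \<xi> m)) (p, x)))))"

definition twisted_principal_bundle ::
  "('b::topological_space, 'm::topological_space, 'e::topological_space, 'n::finite, 'r::finite) tp_bundle
     \<Rightarrow> bool" where
  "twisted_principal_bundle B \<longleftrightarrow>
     smooth_atlas (base_atlas B) \<and> smooth_atlas (total_atlas B) \<and>
     \<comment> \<open>fibre bundle\<close>
     (\<forall>b. \<exists>U \<beta> \<xi>. (U, \<beta>, \<xi>) \<in> fiber_charts B \<and> b \<in> U) \<and>
     flat_vector_bundle B \<and>
     \<comment> \<open>smooth fibrewise action of the additive groups of the fibres\<close>
     (\<forall>e m. vproj B e = proj B m \<longrightarrow> proj B (act B e m) = proj B m) \<and>
     (\<forall>(U, \<psi>)\<in>frames B. \<forall>m\<in>proj B -` U.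
        (\<forall>e. vproj B e = proj B m \<and> \<psi> e = 0 \<longrightarrow> act B e m = m) \<and>
        (\<forall>e e' e''. vproj B e = proj B m \<and> vproj B e' = proj B m \<and> vproj B e'' = proj B m \<and>
           \<psi> e'' = \<psi> e + \<psi> e' \<longrightarrow> act B e'' m = act B e (act B e' m))) \<and>
     smooth_action B \<and>
     \<comment> \<open>free and transitive on the fibres\<close>
     (\<forall>e e' m. vproj B e = proj B m \<and> vproj B e' = proj B m \<and> act B e m = act B e' m \<longrightarrow> e = e') \<and>
     (\<forall>m m'. proj B m = proj B m' \<longrightarrow> (\<exists>e. vproj B e = proj B m \<and> act B e m = m'))"

text \<open>Coordinates \<open>(b, x)\<close> whose fibre part comes from a flat local frame: the action of \<open>e\<close>
  is translation by the components of \<open>e\<close>.\<close>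

definition adapted_charts ::
  "('b::topological_space, 'm::topological_space, 'e::topological_space, 'n::finite, 'r::finite) tp_bundle
     \<Rightarrow> ('b, 'm, 'n, 'r) fchart set" where
  "adapted_charts B = {(U, \<beta>, \<xi>). (U, \<beta>, \<xi>) \<in> fiber_charts B \<and>
     (\<exists>\<psi>. (U, \<psi>) \<in> flat_frames B \<and>
        (\<forall>e m. proj B m \<in> U \<and> vproj B e = proj B m \<longrightarrow> \<xi> (act B e m) = \<psi> e + \<xi> m))}"

section \<open>Locally invariant metrics\<close>

text \<open>A metric is given by its value \<open>h c m u v\<close> at the point \<open>m\<close> on the tangent vectors whose
  components in the chart \<open>c\<close> are \<open>u\<close> and \<open>v\<close>.\<close>

type_synonym ('a, 'v) chart_metric = "('a, 'v) chart \<Rightarrow> 'a \<Rightarrow> 'v \<Rightarrow> 'v \<Rightarrow> real"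

text \<open>\<open>F\<close> preserves the metric \<open>h\<close> at the points of \<open>W\<close>. For \<open>F = id\<close> this is the transformation
  law under changes of charts.\<close>

definition preserves_metric ::
  "('a::topological_space, 'v::euclidean_space) chart set \<Rightarrow> ('a, 'v) chart_metric \<Rightarrow> 'a set \<Rightarrow> ('a \<Rightarrow> 'a) \<Rightarrow> bool"
  where
  "preserves_metric \<A> h W F \<longleftrightarrow>
     (\<forall>m\<in>W. \<forall>(U, \<phi>)\<in>charts \<A>. \<forall>(V, \<psi>)\<in>charts \<A>. m \<in> U \<and> F m \<in> V \<longrightarrow>
        (let D = frechet_derivative (\<psi> \<circ> F \<circ> inv_into U \<phi>) (at (\<phi> m))
         in \<forall>u v. h (V, \<psi>) (F m) (D u) (D v) = h (U, \<phi>) m u v))"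

definition riemannian_metric ::
  "('a::topological_space, 'v::euclidean_space) chart set \<Rightarrow> ('a, 'v) chart_metric \<Rightarrow> bool" where
  "riemannian_metric \<A> h \<longleftrightarrow>
     (\<forall>(U, \<phi>)\<in>charts \<A>.
        (\<forall>m\<in>U. bilinear (h (U, \<phi>) m) \<and> (\<forall>u v. h (U, \<phi>) m u v = h (U, \<phi>) m v u) \<and>
           (\<forall>v. v \<noteq> 0 \<longrightarrow> h (U, \<phi>) m v v > 0)) \<and>
        (\<forall>u v. smooth_on (\<phi> ` U) (\<lambda>q. h (U, \<phi>) (inv_into U \<phi> q) u v))) \<and>
     preserves_metric \<A> h UNIV id"

text \<open>Local invariance: flat local sections of the vector bundle act isometrically.\<close>

definition locally_invariant_metric ::
  "('b::topological_space, 'm::topological_space, 'e::topological_space, 'n::finite, 'r::finite) tp_bundle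
     \<Rightarrow> ('m, (real ^ 'n) \<times> (real ^ 'r)) chart_metric \<Rightarrow> bool" where
  "locally_invariant_metric B h \<longleftrightarrow> riemannian_metric (total_atlas B) h \<and>
     (\<forall>(W, \<psi>)\<in>flat_frames B. \<forall>\<sigma> v.
        (\<forall>b\<in>W. vproj B (\<sigma> b) = b \<and> \<psi> (\<sigma> b) = v) \<longrightarrow>
        preserves_metric (total_atlas B) h (proj B -` W) (\<lambda>m. act B (\<sigma> (proj B m)) m))"

text \<open>In the chart, \<open>h\<close> has the form
  \<open>g\<^sub>\<alpha>\<^sub>\<beta> db\<^sup>\<alpha> db\<^sup>\<beta> + G\<^sub>i\<^sub>j (dx\<^sup>i + A\<^sup>i\<^sub>\<alpha> db\<^sup>\<alpha>) (dx\<^sup>j + A\<^sup>j\<^sub>\<beta> db\<^sup>\<beta>)\<close>,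
  where \<open>g p $ \<alpha> $ \<beta>\<close>, \<open>A p $ i $ \<alpha>\<close> and \<open>G p $ i $ j\<close> are functions of the base coordinates \<open>p\<close>.\<close>

definition has_components ::
  "('b, 'm, 'e, 'n::finite, 'r::finite) tp_bundle \<Rightarrow> ('m, (real ^ 'n) \<times> (real ^ 'r)) chart_metric
     \<Rightarrow> ('b, 'm, 'n, 'r) fchart
     \<Rightarrow> (real ^ 'n \<Rightarrow> real ^ 'n ^ 'n) \<Rightarrow> (real ^ 'n \<Rightarrow> real ^ 'n ^ 'r) \<Rightarrow> (real ^ 'n \<Rightarrow> real ^ 'r ^ 'r) \<Rightarrow> bool"
  where
  "has_components B h c g A G \<longleftrightarrow> (case c of (U, \<beta>, \<xi>) \<Rightarrow>
     \<forall>m\<in>proj B -` U. \<forall>u v y z. let p = \<beta> (proj B m) in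
       h (total_chart B c) m (u, y) (v, z) =
         u \<bullet> (g p *v v) + (y + A p *v u) \<bullet> (G p *v (z + A p *v v)))"

section \<open>Tensor calculus in base coordinates\<close>

definition pd :: "'n \<Rightarrow> (real ^ 'n \<Rightarrow> 'w::real_normed_vector) \<Rightarrow> real ^ 'n::finite \<Rightarrow> 'w" where
  "pd \<alpha> f p = frechet_derivative f (at p) (axis \<alpha> 1)"

text \<open>\<open>christoffel g \<gamma> \<alpha> \<beta>\<close> is \<open>\<Gamma>\<^sup>\<gamma>\<^sub>\<alpha>\<^sub>\<beta>\<close>.\<close>

definition christoffel :: "(real ^ 'n \<Rightarrow> real ^ 'n ^ 'n) \<Rightarrow> 'n \<Rightarrow> 'n \<Rightarrow> 'n \<Rightarrow> real ^ 'n::finite \<Rightarrow> real" where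
  "christoffel g \<gamma> \<alpha> \<beta> p = 1/2 * (\<Sum>\<delta>\<in>UNIV. matrix_inv (g p) $ \<gamma> $ \<delta> *
     (pd \<alpha> (\<lambda>q. g q $ \<beta> $ \<delta>) p + pd \<beta> (\<lambda>q. g q $ \<alpha> $ \<delta>) p - pd \<delta> (\<lambda>q. g q $ \<alpha> $ \<beta>) p))"

definition ricci :: "(real ^ 'n \<Rightarrow> real ^ 'n ^ 'n) \<Rightarrow> 'n \<Rightarrow> 'n \<Rightarrow> real ^ 'n::finite \<Rightarrow> real" where
  "ricci g \<alpha> \<beta> p =
     (\<Sum>\<gamma>\<in>UNIV. pd \<gamma> (christoffel g \<gamma> \<alpha> \<beta>) p - pd \<beta> (christoffel g \<gamma> \<alpha> \<gamma>) p) +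
     (\<Sum>\<gamma>\<in>UNIV. \<Sum>\<delta>\<in>UNIV. christoffel g \<gamma> \<gamma> \<delta> p * christoffel g \<delta> \<alpha> \<beta> p
                         - christoffel g \<gamma> \<beta> \<delta> p * christoffel g \<delta> \<alpha> \<gamma> p)"

definition laplacian ::
  "(real ^ 'n \<Rightarrow> real ^ 'n ^ 'n) \<Rightarrow> (real ^ 'n \<Rightarrow> real) \<Rightarrow> real ^ 'n::finite \<Rightarrow> real" where
  "laplacian g f p = (\<Sum>\<alpha>\<in>UNIV. \<Sum>\<beta>\<in>UNIV. matrix_inv (g p) $ \<alpha> $ \<beta> *
     (pd \<alpha> (pd \<beta> f) p - (\<Sum>\<gamma>\<in>UNIV. christoffel g \<gamma> \<alpha> \<beta> p * pd \<gamma> f p)))"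

text \<open>\<open>curv A i \<alpha> \<beta>\<close> is \<open>(dA)\<^sup>i\<^sub>\<alpha>\<^sub>\<beta>\<close>.\<close>

definition curv ::
  "(real ^ 'n \<Rightarrow> real ^ 'n ^ 'r) \<Rightarrow> 'r::finite \<Rightarrow> 'n \<Rightarrow> 'n \<Rightarrow> real ^ 'n::finite \<Rightarrow> real" where
  "curv A i \<alpha> \<beta> p = pd \<alpha> (\<lambda>q. A q $ i $ \<beta>) p - pd \<beta> (\<lambda>q. A q $ i $ \<alpha>) p"

text \<open>The formal adjoint of \<open>d\<close> on 2-forms, \<open>(\<delta>\<omega>)\<^sub>\<alpha> = - g\<^sup>\<gamma>\<^sup>\<beta> \<nabla>\<^sub>\<gamma> \<omega>\<^sub>\<beta>\<^sub>\<alpha>\<close>.\<close>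

definition codiff ::
  "(real ^ 'n \<Rightarrow> real ^ 'n ^ 'n) \<Rightarrow> ('n \<Rightarrow> 'n \<Rightarrow> real ^ 'n \<Rightarrow> real) \<Rightarrow> 'n \<Rightarrow> real ^ 'n::finite \<Rightarrow> real" where
  "codiff g \<omega> \<alpha> p = - (\<Sum>\<gamma>\<in>UNIV. \<Sum>\<beta>\<in>UNIV. matrix_inv (g p) $ \<gamma> $ \<beta> *
     (pd \<gamma> (\<omega> \<beta> \<alpha>) p - (\<Sum>\<epsilon>\<in>UNIV. christoffel g \<epsilon> \<gamma> \<beta> p * \<omega> \<epsilon> \<alpha> p + christoffel g \<epsilon> \<gamma> \<alpha> p * \<omega> \<beta> \<epsilon> p)))"

text \<open>\<open>g\<^sup>\<alpha>\<^sup>\<gamma> g\<^sup>\<beta>\<^sup>\<delta> G\<^sub>i\<^sub>k G\<^sub>j\<^sub>l (dA)\<^sup>k\<^sub>\<alpha>\<^sub>\<beta> (dA)\<^sup>l\<^sub>\<gamma>\<^sub>\<delta>\<close>\<close>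

definition curv_term ::
  "(real ^ 'n \<Rightarrow> real ^ 'n ^ 'n) \<Rightarrow> (real ^ 'n \<Rightarrow> real ^ 'n ^ 'r) \<Rightarrow> (real ^ 'n \<Rightarrow> real ^ 'r ^ 'r)
     \<Rightarrow> 'r::finite \<Rightarrow> 'r \<Rightarrow> real ^ 'n::finite \<Rightarrow> real" where
  "curv_term g A G i j p =
     (\<Sum>\<alpha>\<in>UNIV. \<Sum>\<beta>\<in>UNIV. \<Sum>\<gamma>\<in>UNIV. \<Sum>\<delta>\<in>UNIV. \<Sum>k\<in>UNIV. \<Sum>l\<in>UNIV.
        matrix_inv (g p) $ \<alpha> $ \<gamma> * matrix_inv (g p) $ \<beta> $ \<delta> *
        G p $ i $ k * G p $ j $ l * curv A k \<alpha> \<beta> p * curv A l \<gamma> \<delta> p)"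

section \<open>The locally invariant Ricci flow\<close>

definition flow_rhs_g ::
  "(real ^ 'n \<Rightarrow> real ^ 'n ^ 'n) \<Rightarrow> (real ^ 'n \<Rightarrow> real ^ 'n ^ 'r) \<Rightarrow> (real ^ 'n \<Rightarrow> real ^ 'r ^ 'r::finite)
     \<Rightarrow> 'n \<Rightarrow> 'n \<Rightarrow> real ^ 'n::finite \<Rightarrow> real" where
  "flow_rhs_g g A G \<alpha> \<beta> p = - 2 * ricci g \<alpha> \<beta> p
     + 1/2 * (\<Sum>i\<in>UNIV. \<Sum>j\<in>UNIV. \<Sum>k\<in>UNIV. \<Sum>l\<in>UNIV.
         matrix_inv (G p) $ i $ k * matrix_inv (G p) $ j $ l *
         pd \<alpha> (\<lambda>q. G q $ i $ j) p * pd \<beta> (\<lambda>q. G q $ k $ l) p)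
     + (\<Sum>\<gamma>\<in>UNIV. \<Sum>\<delta>\<in>UNIV. \<Sum>i\<in>UNIV. \<Sum>j\<in>UNIV.
         matrix_inv (g p) $ \<gamma> $ \<delta> * G p $ i $ j * curv A i \<alpha> \<gamma> p * curv A j \<beta> \<delta> p)"

definition flow_rhs_A ::
  "(real ^ 'n \<Rightarrow> real ^ 'n ^ 'n) \<Rightarrow> (real ^ 'n \<Rightarrow> real ^ 'n ^ 'r) \<Rightarrow> (real ^ 'n \<Rightarrow> real ^ 'r ^ 'r)
     \<Rightarrow> 'r::finite \<Rightarrow> 'n \<Rightarrow> real ^ 'n::finite \<Rightarrow> real" where
  "flow_rhs_A g A G i \<alpha> p = - codiff g (curv A i) \<alpha> p
     + (\<Sum>j\<in>UNIV. \<Sum>k\<in>UNIV. \<Sum>\<beta>\<in>UNIV. \<Sum>\<gamma>\<in>UNIV.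
         matrix_inv (G p) $ i $ j * matrix_inv (g p) $ \<beta> $ \<gamma> *
         pd \<gamma> (\<lambda>q. G q $ j $ k) p * curv A k \<beta> \<alpha> p)"

definition flow_rhs_G ::
  "(real ^ 'n \<Rightarrow> real ^ 'n ^ 'n) \<Rightarrow> (real ^ 'n \<Rightarrow> real ^ 'n ^ 'r) \<Rightarrow> (real ^ 'n \<Rightarrow> real ^ 'r ^ 'r)
     \<Rightarrow> 'r::finite \<Rightarrow> 'r \<Rightarrow> real ^ 'n::finite \<Rightarrow> real" where
  "flow_rhs_G g A G i j p = laplacian g (\<lambda>q. G q $ i $ j) p
     - (\<Sum>k\<in>UNIV. \<Sum>l\<in>UNIV. \<Sum>\<alpha>\<in>UNIV. \<Sum>\<beta>\<in>UNIV.
         matrix_inv (G p) $ k $ l * matrix_inv (g p) $ \<alpha> $ \<beta> *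
         pd \<alpha> (\<lambda>q. G q $ i $ k) p * pd \<beta> (\<lambda>q. G q $ l $ j) p)
     - 1/2 * curv_term g A G i j p"

text \<open>\<open>h\<close> is a time-dependent locally invariant metric, and \<open>g c t\<close>, \<open>A c t\<close>, \<open>G c t\<close> are the
  components of \<open>h t\<close> in the adapted chart \<open>c\<close>.\<close>

definition invariant_ricci_flow ::
  "('b::topological_space, 'm::topological_space, 'e::topological_space, 'n::finite, 'r::finite) tp_bundle
     \<Rightarrow> real set \<Rightarrow> (real \<Rightarrow> ('m, (real ^ 'n) \<times> (real ^ 'r)) chart_metric)
     \<Rightarrow> (('b, 'm, 'n, 'r) fchart \<Rightarrow> real \<Rightarrow> real ^ 'n \<Rightarrow> real ^ 'n ^ 'n)
     \<Rightarrow> (('b, 'm, 'n, 'r) fchart \<Rightarrow> real \<Rightarrow> real ^ 'n \<Rightarrow> real ^ 'n ^ 'r)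
     \<Rightarrow> (('b, 'm, 'n, 'r) fchart \<Rightarrow> real \<Rightarrow> real ^ 'n \<Rightarrow> real ^ 'r ^ 'r) \<Rightarrow> bool" where
  "invariant_ricci_flow B T h g A G \<longleftrightarrow> is_interval T \<and> interior T \<noteq> {} \<and>
     (\<forall>t\<in>T. locally_invariant_metric B (h t)) \<and>
     (\<forall>c\<in>adapted_charts B. case c of (U, \<beta>, \<xi>) \<Rightarrow> \<forall>t\<in>T.
        has_components B (h t) c (g c t) (A c t) (G c t) \<and>
        (\<forall>p\<in>\<beta> ` U.
          (\<forall>\<alpha> \<beta>'. ((\<lambda>s. g c s p $ \<alpha> $ \<beta>') has_real_derivative
             flow_rhs_g (g c t) (A c t) (G c t) \<alpha> \<beta>' p) (at t within T)) \<and>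
          (\<forall>i \<alpha>. ((\<lambda>s. A c s p $ i $ \<alpha>) has_real_derivative
             flow_rhs_A (g c t) (A c t) (G c t) i \<alpha> p) (at t within T)) \<and>
          (\<forall>i j. ((\<lambda>s. G c s p $ i $ j) has_real_derivative
             flow_rhs_G (g c t) (A c t) (G c t) i j p) (at t within T))))"

section \<open>Levi-Civita connections and tension fields\<close>

text \<open>The target is a submanifold \<open>S\<close> of a Euclidean space, with tangent spaces \<open>TS P\<close> and
  Riemannian metric \<open>h\<close>, where \<open>h Q\<close> is defined for \<open>Q\<close> in a neighbourhood of \<open>S\<close>. Vector
  fields on \<open>S\<close> are represented by smooth extensions to a neighbourhood of \<open>S\<close>; derivatives
  of extensions are only taken in directions tangent to \<open>S\<close>, so they do not depend on the
  extension. Every affine connection on \<open>S\<close> is of the form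
  \<open>\<nabla>\<^sub>X Y = D\<^sub>X Y + \<Gamma>(X, Y)\<close> with a unique field \<open>\<Gamma>\<close> of bilinear maps on the tangent spaces, where \<open>D\<close>
  is the derivative of the ambient space. The values of \<open>\<Gamma>\<close> need not be tangent to \<open>S\<close>.\<close>

definition tangent_field :: "'v set \<Rightarrow> ('v \<Rightarrow> 'v set) \<Rightarrow> ('v::euclidean_space \<Rightarrow> 'v) \<Rightarrow> bool" where
  "tangent_field S TS X \<longleftrightarrow> (\<exists>W. open W \<and> S \<subseteq> W \<and> smooth_on W X) \<and> (\<forall>P\<in>S. X P \<in> TS P)"

definition cov :: "('v \<Rightarrow> 'v \<Rightarrow> 'v \<Rightarrow> 'v) \<Rightarrow> ('v \<Rightarrow> 'v) \<Rightarrow> ('v::euclidean_space \<Rightarrow> 'v) \<Rightarrow> 'v \<Rightarrow> 'v" where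
  "cov \<Gamma> X Y P = frechet_derivative Y (at P) (X P) + \<Gamma> P (X P) (Y P)"

definition is_levi_civita ::
  "'v set \<Rightarrow> ('v \<Rightarrow> 'v set) \<Rightarrow> ('v \<Rightarrow> 'v \<Rightarrow> 'v \<Rightarrow> real) \<Rightarrow> ('v::euclidean_space \<Rightarrow> 'v \<Rightarrow> 'v \<Rightarrow> 'v) \<Rightarrow> bool"
  where
  "is_levi_civita S TS h \<Gamma> \<longleftrightarrow>
     \<comment> \<open>affine connection\<close>
     (\<forall>P\<in>S. \<forall>u\<in>TS P. \<forall>v\<in>TS P. \<forall>w\<in>TS P. \<forall>a b.
        \<Gamma> P (a *\<^sub>R u + b *\<^sub>R v) w = a *\<^sub>R \<Gamma> P u w + b *\<^sub>R \<Gamma> P v w \<and>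
        \<Gamma> P w (a *\<^sub>R u + b *\<^sub>R v) = a *\<^sub>R \<Gamma> P w u + b *\<^sub>R \<Gamma> P w v) \<and>
     (\<forall>X Y. tangent_field S TS X \<and> tangent_field S TS Y \<longrightarrow> (\<forall>P\<in>S. cov \<Gamma> X Y P \<in> TS P)) \<and>
     \<comment> \<open>torsion-free\<close>
     (\<forall>X Y. tangent_field S TS X \<and> tangent_field S TS Y \<longrightarrow> (\<forall>P\<in>S.
        cov \<Gamma> X Y P - cov \<Gamma> Y X P =
          frechet_derivative Y (at P) (X P) - frechet_derivative X (at P) (Y P))) \<and>
     \<comment> \<open>metric\<close>
     (\<forall>X Y Z. tangent_field S TS X \<and> tangent_field S TS Y \<and> tangent_field S TS Z \<longrightarrow> (\<forall>P\<in>S.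
        frechet_derivative (\<lambda>Q. h Q (Y Q) (Z Q)) (at P) (X P) =
          h P (cov \<Gamma> X Y P) (Z P) + h P (Y P) (cov \<Gamma> X Z P)))"

text \<open>The Levi-Civita connection is unique, so the choice only concerns values of \<open>\<Gamma>\<close> off the
  tangent spaces of \<open>S\<close>.\<close>

definition levi_civita ::
  "'v set \<Rightarrow> ('v \<Rightarrow> 'v set) \<Rightarrow> ('v \<Rightarrow> 'v \<Rightarrow> 'v \<Rightarrow> real) \<Rightarrow> 'v::euclidean_space \<Rightarrow> 'v \<Rightarrow> 'v \<Rightarrow> 'v" where
  "levi_civita S TS h = (SOME \<Gamma>. is_levi_civita S TS h \<Gamma>)"

text \<open>\<open>(\<nabla>d\<phi>)(\<partial>\<^sub>\<alpha>, \<partial>\<^sub>\<beta>) = \<nabla>\<^sup>\<phi>\<^sub>\<alpha> (\<partial>\<^sub>\<beta>\<phi>) - d\<phi>(\<nabla>\<^sub>\<alpha> \<partial>\<^sub>\<beta>)\<close>, where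
  \<open>\<nabla>\<^sup>\<phi>\<^sub>\<alpha> Z = \<partial>\<^sub>\<alpha> Z + \<Gamma>(\<partial>\<^sub>\<alpha>\<phi>, Z)\<close> is the pull-back of the Levi-Civita connection of the target.\<close>

definition map_hessian ::
  "(real ^ 'n \<Rightarrow> real ^ 'n ^ 'n) \<Rightarrow> 'v set \<Rightarrow> ('v \<Rightarrow> 'v set) \<Rightarrow> ('v \<Rightarrow> 'v \<Rightarrow> 'v \<Rightarrow> real)
     \<Rightarrow> (real ^ 'n \<Rightarrow> 'v::euclidean_space) \<Rightarrow> 'n \<Rightarrow> 'n \<Rightarrow> real ^ 'n::finite \<Rightarrow> 'v" where
  "map_hessian g S TS h \<phi> \<alpha> \<beta> p =
     pd \<alpha> (pd \<beta> \<phi>) p + levi_civita S TS h (\<phi> p) (pd \<alpha> \<phi> p) (pd \<beta> \<phi> p)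
     - (\<Sum>\<gamma>\<in>UNIV. christoffel g \<gamma> \<alpha> \<beta> p *\<^sub>R pd \<gamma> \<phi> p)"

definition tension ::
  "(real ^ 'n \<Rightarrow> real ^ 'n ^ 'n) \<Rightarrow> 'v set \<Rightarrow> ('v \<Rightarrow> 'v set) \<Rightarrow> ('v \<Rightarrow> 'v \<Rightarrow> 'v \<Rightarrow> real)
     \<Rightarrow> (real ^ 'n \<Rightarrow> 'v::euclidean_space) \<Rightarrow> real ^ 'n::finite \<Rightarrow> 'v" where
  "tension g S TS h \<phi> p =
     (\<Sum>\<alpha>\<in>UNIV. \<Sum>\<beta>\<in>UNIV. matrix_inv (g p) $ \<alpha> $ \<beta> *\<^sub>R map_hessian g S TS h \<phi> \<alpha> \<beta> p)"

section \<open>The space of inner products of fixed volume\<close>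

text \<open>The volume of an inner product is the square root of its determinant.\<close>

definition SN :: "real \<Rightarrow> (real ^ 'r ^ 'r::finite) set" where
  "SN \<kappa> = {P. transpose P = P \<and> (\<forall>x. x \<noteq> 0 \<longrightarrow> x \<bullet> (P *v x) > 0) \<and> det P = \<kappa>}"

definition tangent_SN :: "real ^ 'r ^ 'r \<Rightarrow> (real ^ 'r ^ 'r::finite) set" where
  "tangent_SN P = {X. transpose X = X \<and> trace (matrix_inv P ** X) = 0}"

definition gbar :: "real ^ 'r ^ 'r \<Rightarrow> real ^ 'r ^ 'r \<Rightarrow> real ^ 'r ^ 'r::finite \<Rightarrow> real" where
  "gbar P X Y = trace (matrix_inv P ** X ** matrix_inv P ** Y)"

end

theory Submission
  imports Defs
begin

text \<open>Differentiating \<open>Q\<^sup>-\<^sup>1\<close> shows that the Levi-Civita connection of \<open>S\<^sub>N\<close> is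
  \<open>\<nabla>\<^sub>X Y = D\<^sub>X Y - (X P\<^sup>-\<^sup>1 Y + Y P\<^sup>-\<^sup>1 X) / 2\<close> at \<open>P\<close>. Its correction term, evaluated on
  \<open>\<partial>\<^sub>\<alpha>G\<close> and \<open>\<partial>\<^sub>\<beta>G\<close> and traced with the symmetric \<open>g\<^sup>\<alpha>\<^sup>\<beta>\<close>, is exactly the quadratic
  gradient term of the flow equation for \<open>G\<close>.\<close>

section \<open>Derivatives of the determinant and the inverse\<close>

text \<open>The tension field refers to the connection through a choice operator, so exhibiting one
  connection with the Levi-Civita properties is not enough: uniqueness on tangent vectors has to be
  proved too. Tangent fields are ambient fields whose constraints hold only on
  \<open>SN \<kappa>\<close>, so these constraints can be differentiated only in tangent directions.
  This calls for curves inside \<open>SN \<kappa>\<close> with prescribed velocity, while testing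
  the connection axioms at given vectors calls for tangent fields through them. Both come from
  congruences \<open>K ** P ** transpose K\<close>, the action of the linear group on inner
  products. The symmetrized product with factor 1/2 is forced: the two terms from differentiating
  the inverses in \<open>gbar\<close> have to be shared between the two slots by a correction
  symmetric in its arguments, since torsion vanishes. The flow specifies no regularity of
  \<open>G\<close> in the base coordinates; it is recovered from smoothness of the metric on the
  total space.\<close>

lemma bounded_bilinear_matrix_mult:
  "bounded_bilinear ((**) :: real^'m::finite^'l::finite \<Rightarrow> real^'n::finite^'m \<Rightarrow> real^'n^'l)"
  unfolding bilinear_conv_bounded_bilinear[symmetric] bilinear_def
  by (auto intro!: linearI simp: matrix_matrix_mult_def vec_eq_iff sum.distrib
      algebra_simps sum_distrib_left)

interpretation matrix_mult:
  bounded_bilinear "(**) :: real^'m::finite^'l::finite \<Rightarrow> real^'n::finite^'m \<Rightarrow> real^'n^'l"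
  by (rule bounded_bilinear_matrix_mult)

lemma bounded_linear_trace: "bounded_linear (trace :: real^'n::finite^'n \<Rightarrow> real)"
  unfolding linear_conv_bounded_linear[symmetric]
  by (rule linearI) (simp_all add: trace_def sum.distrib sum_distrib_left)

lemma bounded_linear_transpose:
  "bounded_linear (transpose :: real^'n::finite^'m::finite \<Rightarrow> real^'m^'n)"
  unfolding linear_conv_bounded_linear[symmetric]
  by (rule linearI) (simp_all add: transpose_def vec_eq_iff)

lemmas trace_scaleR = linear_cmul[OF bounded_linear.linear[OF bounded_linear_trace]]
lemmas trace_uminus = linear_neg[OF bounded_linear.linear[OF bounded_linear_trace]]
lemmas transpose_add = linear_add[OF bounded_linear.linear[OF bounded_linear_transpose]]
lemmas transpose_diff = linear_diff[OF bounded_linear.linear[OF bounded_linear_transpose]]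

lemmas matrix_algebra = matrix_mult.add_left matrix_mult.add_right matrix_mult.diff_left
  matrix_mult.diff_right matrix_mult.scaleR_left matrix_mult.scaleR_right
  matrix_mult.minus_left matrix_mult.minus_right

lemma matrix_inv_works:
  fixes A :: "'a::field^'n::finite^'n"
  assumes "invertible A"
  shows "matrix_inv A ** A = mat 1" "A ** matrix_inv A = mat 1"
  using someI_ex[OF assms[unfolded invertible_def]] by (auto simp: matrix_inv_def)

lemma matrix_inv_unique:
  fixes A B :: "'a::field^'n::finite^'n"
  assumes "A ** B = mat 1"
  shows "matrix_inv A = B"
  by (metis assms invertible_right_inverse matrix_inv_works(1) matrix_mul_assoc matrix_mul_lid
      matrix_mul_rid)

lemma transpose_matrix_inv:
  fixes A :: "'a::field^'n::finite^'n"
  assumes "invertible A"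
  shows "transpose (matrix_inv A) = matrix_inv (transpose A)"
  by (metis assms matrix_inv_unique matrix_inv_works(1) matrix_transpose_mul transpose_mat)

lemma invertible_if_posdef:
  fixes A :: "real^'n::finite^'n"
  assumes "\<And>x. x \<noteq> 0 \<Longrightarrow> x \<bullet> (A *v x) > 0"
  shows "invertible A"
  unfolding invertible_left_inverse matrix_left_invertible_ker
  using assms by fastforce

lemma has_derivative_entry: "((\<lambda>A::real^'n::finite^'m::finite. A $ i $ j) has_derivative (\<lambda>A. A $ i $ j)) F"
  by (intro bounded_linear_imp_has_derivative
      bounded_linear_compose[OF bounded_linear_vec_nth bounded_linear_vec_nth, unfolded o_def])

lemma differentiable_entry: "(\<lambda>A::real^'n::finite^'m::finite. A $ i $ j) differentiable F"
  using has_derivative_entry differentiable_def by blast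

lemma differentiable_entrywise:
  fixes f :: "'v::euclidean_space \<Rightarrow> real^'n::finite^'m::finite"
  assumes "\<And>i j. (\<lambda>x. f x $ i $ j) differentiable (at x)"
  shows "f differentiable (at x)"
  unfolding differentiable_componentwise_within[of f]
  using assms by (auto simp: Basis_vec_def inner_axis)

lemma has_derivative_det_entries:
  "((det :: real^'n::finite^'n \<Rightarrow> real) has_derivative
     (\<lambda>X. \<Sum>p | p permutes UNIV. of_int (sign p) *
        (\<Sum>i\<in>UNIV. X $ i $ p i * (\<Prod>j\<in>UNIV - {i}. A $ j $ p j)))) (at A)"
  unfolding det_def[abs_def]
  by (intro has_derivative_sum has_derivative_mult_right has_derivative_prod has_derivative_entry)

lemma differentiable_det: "(det :: real^'n::finite^'n \<Rightarrow> real) differentiable (at A)"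
  using has_derivative_det_entries differentiable_def by blast

text \<open>Only the identity permutation contributes: every other one moves at least two indices.\<close>

lemma has_derivative_det_mat_1:
  "((det :: real^'n::finite^'n \<Rightarrow> real) has_derivative trace) (at (mat 1))"
proof -
  let ?I = "mat 1 :: real^'n^'n"
  let ?P = "{p. p permutes (UNIV::'n set)}"
  let ?t = "\<lambda>p X. \<Sum>i\<in>UNIV. X $ i $ p i * (\<Prod>j\<in>UNIV - {i}. ?I $ j $ p j)"
  have "(det has_derivative (\<lambda>X. \<Sum>p\<in>?P. of_int (sign p) * ?t p X)) (at ?I)"
    by (rule has_derivative_det_entries)
  moreover have "(\<Sum>p\<in>?P. of_int (sign p) * ?t p X) = trace X" for X :: "real^'n^'n"
  proof -
    have "?t p X = 0" if p: "p \<in> ?P" "p \<noteq> id" for p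
    proof (rule sum.neutral, safe)
      fix i
      obtain a where a: "p a \<noteq> a" using p by fastforce
      have inj: "inj p" using p by (auto simp: permutes_inj)
      \<comment> \<open>The product omits index i, so a moved index other than i is wanted. If a is
        i itself, then \<open>p a\<close> is moved as well, by injectivity.\<close>
      obtain j where j: "j \<noteq> i" "p j \<noteq> j"
      proof (cases "a = i")
        case True
        show ?thesis
          by (rule that[of "p a"]) (use a inj True in \<open>auto simp: inj_eq\<close>)
      qed (use a in auto)
      then have "(\<Prod>j\<in>UNIV - {i}. ?I $ j $ p j) = 0"
        by (intro prod_zero) (auto simp: mat_def intro!: bexI[of _ j])
      then show "X $ i $ p i * (\<Prod>j\<in>UNIV - {i}. ?I $ j $ p j) = 0" by simp
    qed
    then have "(\<Sum>p\<in>?P. of_int (sign p) * ?t p X) = (\<Sum>p\<in>{id}. of_int (sign p) * ?t p X)"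
      by (intro sum.mono_neutral_right) (auto simp: permutes_id)
    also have "\<dots> = trace X"
      by (simp add: sign_id trace_def mat_def)
    finally show ?thesis .
  qed
  ultimately show ?thesis by simp
qed

text \<open>Jacobi's formula: writing det Q as det A times det(A^-1 Q) moves the base point to the
  identity.\<close>

lemma has_derivative_det:
  fixes A :: "real^'n::finite^'n"
  assumes "invertible A"
  shows "(det has_derivative (\<lambda>X. det A * trace (matrix_inv A ** X))) (at A)"
proof -
  have "((\<lambda>Q. det (matrix_inv A ** Q)) has_derivative (\<lambda>X. trace (matrix_inv A ** X))) (at A)"
    by (rule has_derivative_compose[of "\<lambda>Q. matrix_inv A ** Q" "\<lambda>X. matrix_inv A ** X" A UNIV det trace])
      (auto simp: matrix_inv_works[OF assms] has_derivative_det_mat_1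
        intro!: bounded_linear_imp_has_derivative matrix_mult.bounded_linear_right)
  from has_derivative_mult_right[OF this, of "det A"] show ?thesis
    by (simp add: det_mul[symmetric] matrix_mul_assoc matrix_inv_works[OF assms])
qed

lemma open_invertible: "open {A :: real^'n::finite^'n. invertible A}"
proof -
  have "continuous_on UNIV (det :: real^'n^'n \<Rightarrow> real)"
    by (intro continuous_at_imp_continuous_on ballI differentiable_imp_continuous_within differentiable_det)
  then show ?thesis
    unfolding invertible_det_nz by (rule open_Collect_neq) (rule continuous_on_const)
qed

text \<open>By Cramer's rule, entry (k, l) of the inverse is det \<open>?M\<close> / det Q, where
  \<open>?M\<close> replaces column k of Q by the l-th unit vector. This holds on the open set of
  invertible matrices, hence near A.\<close>

lemma differentiable_matrix_inv:
  fixes A :: "real^'n::finite^'n"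
  assumes A: "invertible A"
  shows "matrix_inv differentiable (at A)"
proof (rule differentiable_entrywise)
  fix k l :: 'n
  let ?M = "\<lambda>Q::real^'n^'n. (\<chi> i j. if j = k then axis l 1 $ i else Q $ i $ j)::real^'n^'n"
  have "?M differentiable (at A)"
  proof (rule differentiable_entrywise)
    fix i j
    show "(\<lambda>Q. ?M Q $ i $ j) differentiable (at A)"
      by (cases "j = k") (simp_all add: differentiable_entry)
  qed
  then have d: "(\<lambda>Q. det (?M Q)) differentiable (at A)"
    using differentiable_chain_at[OF _ differentiable_det] by (auto simp: o_def)
  have eq: "det (?M Q) / det Q = matrix_inv Q $ k $ l" if "invertible Q" for Q
  proof -
    have "Q *v (matrix_inv Q *v axis l 1) = axis l 1"
      by (simp add: matrix_vector_mul_assoc matrix_inv_works[OF that])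
    then have "matrix_inv Q *v axis l 1 = (\<chi> k. det (\<chi> i j. if j = k then axis l 1 $ i else Q $ i $ j) / det Q)"
      using that by (simp add: cramer invertible_det_nz)
    then have "(matrix_inv Q *v axis l 1) $ k = det (?M Q) / det Q" by simp
    then show ?thesis by (simp add: matrix_vector_mul_component inner_axis)
  qed
  have "(\<lambda>Q. det (?M Q) / det Q) differentiable (at A)"
    using A by (intro differentiable_divide d differentiable_det) (simp add: invertible_det_nz)
  then obtain D where "((\<lambda>Q. det (?M Q) / det Q) has_derivative D) (at A)"
    by (auto simp: differentiable_def)
  then have "((\<lambda>Q. matrix_inv Q $ k $ l) has_derivative D) (at A)"
    by (rule has_derivative_transform_within_open[OF _ open_invertible]) (use A eq in auto)
  then show "(\<lambda>Q. matrix_inv Q $ k $ l) differentiable (at A)"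
    by (rule differentiableI)
qed

text \<open>Differentiability being known, the product rule for Q Q^-1, constant near A, can be
  solved for the derivative.\<close>

lemma has_derivative_matrix_inv:
  fixes A :: "real^'n::finite^'n"
  assumes A: "invertible A"
  shows "(matrix_inv has_derivative (\<lambda>X. - (matrix_inv A ** X ** matrix_inv A))) (at A)"
proof -
  obtain D where D: "(matrix_inv has_derivative D) (at A)"
    using differentiable_matrix_inv[OF A] by (auto simp: differentiable_def)
  have "((\<lambda>Q. Q ** matrix_inv Q) has_derivative (\<lambda>X. A ** D X + X ** matrix_inv A)) (at A)"
    by (intro matrix_mult.FDERIV has_derivative_ident D)
  moreover have "((\<lambda>Q. Q ** matrix_inv Q) has_derivative (\<lambda>_. 0)) (at A)"
    by (rule has_derivative_transform_within_open[OF has_derivative_const open_invertible])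
      (use A in \<open>auto simp: matrix_inv_works\<close>)
  ultimately have "(\<lambda>X. A ** D X + X ** matrix_inv A) = (\<lambda>_. 0)"
    by (rule has_derivative_unique)
  then have "A ** D X = - (X ** matrix_inv A)" for X
    by (metis add_eq_0_iff2)
  then have "matrix_inv A ** (A ** D X) = - (matrix_inv A ** X ** matrix_inv A)" for X
    by (simp add: matrix_mul_assoc matrix_algebra)
  then have "D X = - (matrix_inv A ** X ** matrix_inv A)" for X
    by (simp add: matrix_mul_assoc matrix_inv_works[OF A])
  then have "D = (\<lambda>X. - (matrix_inv A ** X ** matrix_inv A))" by blast
  with D show ?thesis by simp
qed

section \<open>The Levi-Civita connection of the space of inner products\<close>

lemma Ck_on_const: "Ck_on k S (\<lambda>_. c)"
  by (induction k arbitrary: c) auto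

lemma smooth_on_bounded_linear:
  assumes "bounded_linear f"
  shows "smooth_on S f"
proof -
  note deriv = bounded_linear_imp_has_derivative[OF assms]
  have "f differentiable (at x)" "frechet_derivative f (at x) = f" for x
    by (rule differentiableI[OF deriv], rule frechet_derivative_at[OF deriv, symmetric])
  then have "Ck_on k S f" for k
    by (cases k) (simp_all add: Ck_on_const linear_continuous_on[OF assms])
  then show ?thesis by (simp add: smooth_on_def)
qed

section \<open>Curves and tangent fields on the space of inner products\<close>

lemma SN_sym: "P \<in> SN \<kappa> \<Longrightarrow> transpose P = P"
  and SN_det: "P \<in> SN \<kappa> \<Longrightarrow> det P = \<kappa>"
  and SN_invertible: "P \<in> SN \<kappa> \<Longrightarrow> invertible P"
  by (auto simp: SN_def intro!: invertible_if_posdef)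

lemma SN_inv_sym: "P \<in> SN \<kappa> \<Longrightarrow> transpose (matrix_inv P) = matrix_inv P"
  by (simp add: transpose_matrix_inv SN_invertible SN_sym)

lemma trace_transpose: "trace (transpose A) = trace A"
  by (simp add: trace_def transpose_def)

lemma det_scaleR: "det (c *\<^sub>R A) = c ^ CARD('n) * det A" for A :: "real^'n::finite^'n"
proof -
  have "c *\<^sub>R A = (\<chi> i. c *s (A $ i))" by (simp add: vec_eq_iff)
  then show ?thesis using det_rows_mul[of "\<lambda>_. c" "\<lambda>i. A $ i"] by simp
qed

lemma inner_congruence:
  fixes P K :: "real^'n::finite^'n"
  shows "x \<bullet> ((K ** P ** transpose K) *v x) = (transpose K *v x) \<bullet> (P *v (transpose K *v x))"
  by (simp add: matrix_vector_mul_assoc[symmetric] dot_lmul_matrix)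

text \<open>Every tangent vector is an infinitesimal congruence: the generator M/2 gives (M P + P
  M^T)/2 = u, both summands being u/2. This is the origin of the factor 1/2 in the curve and in the
  linear field built from M below.\<close>

lemma tangent_SN_generator:
  fixes P u :: "real^'n::finite^'n"
  assumes P: "P \<in> SN \<kappa>" and u: "u \<in> tangent_SN P"
  defines "M \<equiv> u ** matrix_inv P"
  shows "trace M = 0" "M ** P = u" "P ** transpose M = u"
proof -
  show "trace M = 0"
    using u trace_mul_sym[of u "matrix_inv P"] by (simp add: M_def tangent_SN_def)
  show MP: "M ** P = u"
    by (simp add: M_def matrix_inv_works[OF SN_invertible[OF P]] flip: matrix_mul_assoc)
  show "P ** transpose M = u"
    using arg_cong[OF MP, of transpose] u by (simp add: matrix_transpose_mul SN_sym[OF P] tangent_SN_def)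
qed

text \<open>A congruence multiplies the determinant by (det K)^2 and a scalar c multiplies it by
  c^N, which fixes the exponent -1/N. Using the square keeps the base of the power positive for
  either sign of det K.\<close>

lemma congruence_in_SN:
  fixes P K :: "real^'n::finite^'n"
  assumes P: "P \<in> SN \<kappa>" and K: "det K \<noteq> 0"
  shows "(((det K)\<^sup>2) powr (- 1 / CARD('n))) *\<^sub>R (K ** P ** transpose K) \<in> SN \<kappa>"
proof -
  define c where "c = ((det K)\<^sup>2) powr (- 1 / CARD('n))"
  have c: "c > 0" using K by (simp add: c_def)
  have "c ^ CARD('n) = (det K)\<^sup>2 powr (- 1)"
    using K by (simp add: c_def powr_power)
  then have "c ^ CARD('n) * (det K)\<^sup>2 = 1"
    using K by (simp add: powr_minus)
  moreover have "c ^ CARD('n) * (det K * \<kappa> * det K) = (c ^ CARD('n) * (det K)\<^sup>2) * \<kappa>"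
    by (simp add: power2_eq_square)
  ultimately have "c ^ CARD('n) * (det K * \<kappa> * det K) = \<kappa>"
    by simp
  then have "det (c *\<^sub>R (K ** P ** transpose K)) = \<kappa>"
    by (simp add: det_scaleR det_mul SN_det[OF P])
  moreover have "transpose (c *\<^sub>R (K ** P ** transpose K)) = c *\<^sub>R (K ** P ** transpose K)"
    by (simp add: transpose_scalar matrix_transpose_mul SN_sym[OF P] matrix_mul_assoc)
  moreover have "x \<bullet> ((c *\<^sub>R (K ** P ** transpose K)) *v x) > 0" if "x \<noteq> 0" for x
  proof -
    have "invertible (transpose K)" using K by (simp add: invertible_det_nz)
    then have "transpose K *v x \<noteq> 0"
      using that by (metis invertible_left_inverse matrix_left_invertible_ker)
    then have "(transpose K *v x) \<bullet> (P *v (transpose K *v x)) > 0"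
      using P by (simp add: SN_def)
    then show ?thesis
      using c by (simp add: scaleR_matrix_vector_assoc[symmetric] inner_congruence)
  qed
  ultimately show ?thesis by (simp add: SN_def c_def)
qed

text \<open>The tangent vector \<open>u\<close> is the velocity of the curve \<open>K(s) P K(s)\<^sup>T\<close> with
  \<open>K(s) = 1 + s/2 u P\<^sup>-\<^sup>1\<close>, rescaled to determinant \<open>\<kappa>\<close>; the scaling factor is stationary at
  \<open>s = 0\<close> because \<open>u\<close> is trace-free.\<close>

lemma has_derivative_zero_on_SN:
  fixes P u :: "real^'n::finite^'n" and F :: "real^'n^'n \<Rightarrow> 'w::real_normed_vector"
  assumes P: "P \<in> SN \<kappa>" and u: "u \<in> tangent_SN P"
    and F: "(F has_derivative F') (at P)" and zero: "\<And>Q. Q \<in> SN \<kappa> \<Longrightarrow> F Q = 0"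
  shows "F' u = 0"
proof -
  define M where "M = u ** matrix_inv P"
  define K where "K = (\<lambda>s::real. mat 1 + (s / 2) *\<^sub>R M)"
  define c where "c = (\<lambda>s. ((det (K s))\<^sup>2) powr (- 1 / CARD('n)))"
  define \<gamma> where "\<gamma> = (\<lambda>s. c s *\<^sub>R (K s ** P ** transpose (K s)))"
  note trM = tangent_SN_generator(1)[OF P u, folded M_def] and MP = tangent_SN_generator(2)[OF P u, folded M_def]
    and PM = tangent_SN_generator(3)[OF P u, folded M_def]
  have K0: "K 0 = mat 1" by (simp add: K_def)
  have K: "(K has_derivative (\<lambda>s. (s / 2) *\<^sub>R M)) (at s)" for s
    unfolding K_def by (auto intro!: derivative_eq_intros)
  have "((\<lambda>s. det (K s)) has_derivative (\<lambda>s. trace ((s / 2) *\<^sub>R M))) (at 0)"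
    by (rule has_derivative_compose[OF K, of det trace]) (simp add: K0 has_derivative_det_mat_1)
  then have "((\<lambda>s. det (K s)) has_field_derivative 0) (at 0)"
    by (simp add: has_field_derivative_def trace_scaleR trM lambda_zero)
  then have "((\<lambda>s. (det (K s))\<^sup>2) has_field_derivative 0) (at 0)"
    by (auto intro!: derivative_eq_intros)
  then have "(c has_field_derivative 0) (at 0)"
    unfolding c_def by (rule DERIV_fun_powr[THEN DERIV_cong]) (simp_all add: K0)
  then have c: "(c has_derivative (\<lambda>_. 0)) (at 0)"
    by (simp add: has_field_derivative_def lambda_zero)
  have KT: "((\<lambda>s. transpose (K s)) has_derivative (\<lambda>s. transpose ((s / 2) *\<^sub>R M))) (at 0)"
    by (rule bounded_linear.has_derivative[OF bounded_linear_transpose K])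
  have c0: "c 0 = 1" by (simp add: c_def K0)
  have "(\<gamma> has_derivative (\<lambda>s. s *\<^sub>R u)) (at 0)"
    using has_derivative_scaleR[OF c matrix_mult.FDERIV[OF matrix_mult.FDERIV[OF K has_derivative_const] KT], of P]
    by (simp add: \<gamma>_def K0 c0 transpose_scalar matrix_algebra PM MP flip: scaleR_add_left)
  moreover have \<gamma>0: "\<gamma> 0 = P" by (simp add: \<gamma>_def K0 c0)
  ultimately have "((\<lambda>s. F (\<gamma> s)) has_derivative (\<lambda>s. F' (s *\<^sub>R u))) (at 0)"
    using F by (intro has_derivative_compose[of \<gamma> _ _ _ F F']) simp_all
  moreover have "((\<lambda>s. F (\<gamma> s)) has_derivative (\<lambda>_. 0)) (at 0)"
  \<comment> \<open>The curve stays in \<open>SN \<kappa>\<close> as long as K(s) is invertible,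
    which is an open condition satisfied at s = 0.\<close>
  proof (rule has_derivative_transform_within_open[OF has_derivative_const, where s = "{s. det (K s) \<noteq> 0}"])
    have "isCont (\<lambda>s. det (K s)) s" for s
      using continuous_at_compose[OF has_derivative_continuous[OF K]
          differentiable_imp_continuous_within[OF differentiable_det]]
      by (simp add: o_def)
    then have "continuous_on UNIV (\<lambda>s. det (K s))"
      by (simp add: continuous_at_imp_continuous_on)
    then show "open {s. det (K s) \<noteq> 0}"
      by (rule open_Collect_neq) (rule continuous_on_const)
  qed (use zero congruence_in_SN[OF P] in \<open>auto simp: K0 \<gamma>_def c_def\<close>)
  ultimately have "(\<lambda>s. F' (s *\<^sub>R u)) = (\<lambda>_. 0)"
    by (rule has_derivative_unique)
  then have "F' (1 *\<^sub>R u) = 0" by meson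
  then show ?thesis by simp
qed

text \<open>The infinitesimal action of the trace-free matrix \<open>u P\<^sup>-\<^sup>1\<close> extends \<open>u\<close> to a linear tangent
  field.\<close>

lemma tangent_SN_extend:
  fixes P u :: "real^'n::finite^'n"
  assumes P: "P \<in> SN \<kappa>" and u: "u \<in> tangent_SN P"
  obtains X where "tangent_field (SN \<kappa>) tangent_SN X" "X P = u"
proof -
  define M where "M = u ** matrix_inv P"
  define X where "X = (\<lambda>Q::real^'n^'n. (1/2) *\<^sub>R (M ** Q + Q ** transpose M))"
  note trM = tangent_SN_generator(1)[OF P u, folded M_def] and MP = tangent_SN_generator(2)[OF P u, folded M_def]
    and PM = tangent_SN_generator(3)[OF P u, folded M_def]
  have "X P = u" by (simp add: X_def MP PM)
  have "bounded_linear X"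
    unfolding X_def
    by (intro bounded_linear_intros matrix_mult.bounded_linear_right matrix_mult.bounded_linear_left)
  have "X Q \<in> tangent_SN Q" if Q: "Q \<in> SN \<kappa>" for Q
  proof -
    \<comment> \<open>The first trace is that of a conjugate of M, the second that of the transpose
      of M.\<close>
    have "trace (matrix_inv Q ** (M ** Q)) = 0" "trace (matrix_inv Q ** (Q ** transpose M)) = 0"
      using trM trace_mul_sym[of "matrix_inv Q" "M ** Q"] matrix_inv_works[OF SN_invertible[OF Q]]
      by (simp_all add: trace_transpose matrix_mul_assoc flip: matrix_mul_assoc[of M])
    then show ?thesis
      by (simp add: X_def tangent_SN_def transpose_scalar transpose_add matrix_transpose_mul SN_sym[OF Q]
          matrix_algebra trace_scaleR trace_add add.commute)
  qed
  then have "tangent_field (SN \<kappa>) tangent_SN X"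
    unfolding tangent_field_def using smooth_on_bounded_linear[OF \<open>bounded_linear X\<close>]
    by (intro conjI ballI exI[of _ UNIV]) auto
  with \<open>X P = u\<close> that show ?thesis by blast
qed

section \<open>Existence of the Levi-Civita connection\<close>

text \<open>The trace of \<open>matrix_inv P ** christoffel_SN P X Y\<close> is
  \<open>- gbar P X Y\<close>, so the values are in general not tangent; they cancel the non-tangent
  part of the ambient derivative.\<close>

definition christoffel_SN :: "real^'n^'n \<Rightarrow> real^'n^'n \<Rightarrow> real^'n^'n \<Rightarrow> real^'n::finite^'n" where
  "christoffel_SN P X Y = - (1/2) *\<^sub>R (X ** matrix_inv P ** Y + Y ** matrix_inv P ** X)"

lemma tangent_field_has_derivative:
  assumes "tangent_field S TS Y" "P \<in> S"
  shows "(Y has_derivative frechet_derivative Y (at P)) (at P)"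
proof -
  obtain W where "S \<subseteq> W" "smooth_on W Y"
    using assms(1) by (auto simp: tangent_field_def)
  then have "Ck_on (Suc 0) W Y" by (simp only: smooth_on_def)
  with \<open>S \<subseteq> W\<close> assms(2) show ?thesis
    by (auto simp: frechet_derivative_works[symmetric])
qed

lemma tangent_fieldD: "tangent_field S TS X \<Longrightarrow> P \<in> S \<Longrightarrow> X P \<in> TS P"
  by (auto simp: tangent_field_def)

lemma tangent_SN_diff:
  assumes "X \<in> tangent_SN P" "Y \<in> tangent_SN P"
  shows "X - Y \<in> tangent_SN P"
  using assms by (auto simp: tangent_SN_def transpose_diff matrix_algebra trace_sub)

text \<open>Differentiating the two constraints on Y along the tangent vector X P shows that D_X Y
  is symmetric and that tr(P^-1 D_X Y) = tr(P^-1 X P^-1 Y), which the trace of the correction term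
  cancels.\<close>

lemma cov_christoffel_SN_tangent:
  fixes X Y :: "real^'n::finite^'n \<Rightarrow> real^'n^'n"
  assumes X: "tangent_field (SN \<kappa>) tangent_SN X" and Y: "tangent_field (SN \<kappa>) tangent_SN Y"
    and P: "P \<in> SN \<kappa>"
  shows "cov christoffel_SN X Y P \<in> tangent_SN P"
proof -
  let ?D = "frechet_derivative Y (at P)" and ?u = "X P" and ?v = "Y P" and ?R = "matrix_inv P"
  note D = tangent_field_has_derivative[OF Y P]
  note inv = has_derivative_matrix_inv[OF SN_invertible[OF P]]
  have u: "?u \<in> tangent_SN P" and v: "?v \<in> tangent_SN P"
    using tangent_fieldD X Y P by blast+
  have "transpose (?D ?u) - ?D ?u = 0"
  proof (rule has_derivative_zero_on_SN[OF P u, where F = "\<lambda>Q. transpose (Y Q) - Y Q"])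
    show "((\<lambda>Q. transpose (Y Q) - Y Q) has_derivative (\<lambda>w. transpose (?D w) - ?D w)) (at P)"
      by (intro has_derivative_diff bounded_linear.has_derivative[OF bounded_linear_transpose] D)
    show "transpose (Y Q) - Y Q = 0" if "Q \<in> SN \<kappa>" for Q
      using tangent_fieldD[OF Y that] by (simp add: tangent_SN_def)
  qed
  moreover have "trace (?R ** ?D ?u + - (?R ** ?u ** ?R) ** ?v) = 0"
  proof (rule has_derivative_zero_on_SN[OF P u, where F = "\<lambda>Q. trace (matrix_inv Q ** Y Q)"])
    show "((\<lambda>Q. trace (matrix_inv Q ** Y Q)) has_derivative
        (\<lambda>w. trace (?R ** ?D w + - (?R ** w ** ?R) ** ?v))) (at P)"
      by (intro bounded_linear.has_derivative[OF bounded_linear_trace] matrix_mult.FDERIV D inv)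
    show "trace (matrix_inv Q ** Y Q) = 0" if "Q \<in> SN \<kappa>" for Q
      using tangent_fieldD[OF Y that] by (simp add: tangent_SN_def)
  qed
  then have "trace (?R ** ?D ?u) = trace (?R ** ?u ** ?R ** ?v)"
    by (simp add: matrix_algebra trace_sub)
  moreover have "trace (?R ** ?v ** ?R ** ?u) = trace (?R ** ?u ** ?R ** ?v)"
    using trace_mul_sym[of "?R ** ?v" "?R ** ?u"] by (simp add: matrix_mul_assoc)
  moreover have "transpose ?u = ?u" "transpose ?v = ?v"
    using u v by (auto simp: tangent_SN_def)
  ultimately show ?thesis
    by (simp add: cov_def christoffel_SN_def tangent_SN_def transpose_add transpose_diff transpose_scalar
        matrix_transpose_mul SN_inv_sym[OF P] matrix_algebra trace_add trace_sub trace_scaleR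
        trace_uminus matrix_mul_assoc)
qed

text \<open>With R the inverse of P, differentiating the two inverses produces -tr(R u R Y R Z) and
  -tr(R Y R u R Z). Each slot absorbs half of both, after a cyclic permutation under the
  trace.\<close>

lemma has_derivative_gbar:
  fixes P :: "real^'n::finite^'n"
  assumes P: "invertible P" and Y: "(Y has_derivative DY) (at P)" and Z: "(Z has_derivative DZ) (at P)"
  shows "((\<lambda>Q. gbar Q (Y Q) (Z Q)) has_derivative
    (\<lambda>u. gbar P (DY u + christoffel_SN P u (Y P)) (Z P) + gbar P (Y P) (DZ u + christoffel_SN P u (Z P)))) (at P)"
proof -
  let ?R = "matrix_inv P"
  note inv = has_derivative_matrix_inv[OF P]
  have "((\<lambda>Q. gbar Q (Y Q) (Z Q)) has_derivative (\<lambda>u. trace (?R ** Y P ** ?R ** DZ u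
      + (?R ** Y P ** - (?R ** u ** ?R) + (?R ** DY u + - (?R ** u ** ?R) ** Y P) ** ?R) ** Z P))) (at P)"
    unfolding gbar_def
    by (intro bounded_linear.has_derivative[OF bounded_linear_trace] matrix_mult.FDERIV Y Z inv)
  moreover have "trace (?R ** Y P ** ?R ** Z P ** ?R ** u) = trace (?R ** u ** ?R ** Y P ** ?R ** Z P)" for u
    using trace_mul_sym[of "?R ** Y P ** ?R ** Z P" "?R ** u"] by (simp add: matrix_mul_assoc)
  ultimately show ?thesis
    by (simp add: gbar_def christoffel_SN_def matrix_algebra trace_add trace_sub trace_scaleR trace_uminus
        matrix_mul_assoc algebra_simps)
qed

lemma is_levi_civita_christoffel_SN:
  "is_levi_civita (SN \<kappa>) tangent_SN gbar (christoffel_SN :: real^'n::finite^'n \<Rightarrow> _)"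
  unfolding is_levi_civita_def
proof (intro conjI allI ballI impI; (elim conjE)?)
  fix P u v w :: "real^'n^'n" and a b :: real
  show "christoffel_SN P (a *\<^sub>R u + b *\<^sub>R v) w = a *\<^sub>R christoffel_SN P u w + b *\<^sub>R christoffel_SN P v w"
    "christoffel_SN P w (a *\<^sub>R u + b *\<^sub>R v) = a *\<^sub>R christoffel_SN P w u + b *\<^sub>R christoffel_SN P w v"
    by (simp_all add: christoffel_SN_def matrix_algebra algebra_simps)
next
  fix X Y :: "real^'n^'n \<Rightarrow> real^'n^'n" and P :: "real^'n^'n"
  assume "tangent_field (SN \<kappa>) tangent_SN X" "tangent_field (SN \<kappa>) tangent_SN Y" "P \<in> SN \<kappa>"
  then show "cov christoffel_SN X Y P \<in> tangent_SN P" by (rule cov_christoffel_SN_tangent)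
  show "cov christoffel_SN X Y P - cov christoffel_SN Y X P =
      frechet_derivative Y (at P) (X P) - frechet_derivative X (at P) (Y P)"
    by (simp add: cov_def christoffel_SN_def add.commute)
next
  fix X Y Z :: "real^'n^'n \<Rightarrow> real^'n^'n" and P :: "real^'n^'n"
  assume YZ: "tangent_field (SN \<kappa>) tangent_SN Y" "tangent_field (SN \<kappa>) tangent_SN Z" and P: "P \<in> SN \<kappa>"
  show "frechet_derivative (\<lambda>Q. gbar Q (Y Q) (Z Q)) (at P) (X P) =
      gbar P (cov christoffel_SN X Y P) (Z P) + gbar P (Y P) (cov christoffel_SN X Z P)"
    using has_derivative_gbar[OF SN_invertible[OF P] tangent_field_has_derivative[OF YZ(1) P]
        tangent_field_has_derivative[OF YZ(2) P], THEN frechet_derivative_at]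
    by (simp add: cov_def fun_eq_iff)
qed

section \<open>Uniqueness of the Levi-Civita connection\<close>

lemma gbar_commute: "gbar P X Y = gbar P Y X"
  using trace_mul_sym[of "matrix_inv P ** X" "matrix_inv P ** Y"]
  by (simp add: gbar_def matrix_mul_assoc)

text \<open>For symmetric X this trace is the sum of the squared entries.\<close>

lemma trace_square_sym:
  fixes X :: "real^'n::finite^'n"
  assumes "transpose X = X" "trace (X ** X) = 0"
  shows "X = 0"
proof -
  have "X $ j $ i = X $ i $ j" for i j
    using assms(1) by (metis transpose_def vec_lambda_beta)
  then have "(\<Sum>i\<in>UNIV. \<Sum>j\<in>UNIV. (X $ i $ j)\<^sup>2) = 0"
    using assms(2) by (simp add: trace_def matrix_matrix_mult_def power2_eq_square)
  then show ?thesis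
    by (simp add: sum_nonneg_eq_0_iff sum_nonneg vec_eq_iff)
qed

text \<open>Testing against the trace-free part of \<open>P X P\<close> avoids the positivity of the trace form, which
  would need a square root of \<open>P\<close>.\<close>

lemma gbar_nondegenerate:
  fixes P X :: "real^'n::finite^'n"
  assumes P: "P \<in> SN \<kappa>" and X: "X \<in> tangent_SN P"
    and zero: "\<And>Z. Z \<in> tangent_SN P \<Longrightarrow> gbar P X Z = 0"
  shows "X = 0"
proof -
  let ?R = "matrix_inv P"
  \<comment> \<open>Chosen to make tr(X P - l I) vanish, so that Z is tangent.\<close>
  define l where "l = trace (X ** P) / CARD('n)"
  define Z where "Z = P ** X ** P - l *\<^sub>R P"
  note inv = matrix_inv_works[OF SN_invertible[OF P]]
  have X': "transpose X = X" "trace (?R ** X) = 0" using X by (auto simp: tangent_SN_def)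
  have RZ: "?R ** Z = X ** P - l *\<^sub>R mat 1"
    by (simp add: Z_def matrix_algebra inv matrix_mul_assoc)
  have "transpose Z = Z"
    by (simp add: Z_def transpose_diff transpose_scalar matrix_transpose_mul SN_sym[OF P] X' matrix_mul_assoc)
  moreover have "trace (?R ** Z) = 0"
    by (simp add: RZ trace_sub trace_scaleR trace_I l_def)
  ultimately have "gbar P X Z = 0" using zero by (simp add: tangent_SN_def)
  moreover have "gbar P X Z = trace (?R ** X ** (?R ** Z))"
    by (simp add: gbar_def matrix_mul_assoc)
  \<comment> \<open>The term with l contributes a multiple of tr(P^-1 X), which is zero.\<close>
  moreover have "\<dots> = trace (?R ** (X ** X) ** P)"
    by (simp add: RZ matrix_algebra trace_sub trace_scaleR X' matrix_mul_assoc)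
  moreover have "\<dots> = trace (X ** X)"
    using trace_mul_sym[of "?R ** (X ** X)" P] by (simp add: matrix_mul_assoc inv)
  ultimately show ?thesis using trace_square_sym X' by simp
qed

lemma is_levi_civitaD:
  assumes \<Gamma>: "is_levi_civita S TS h \<Gamma>" and P: "P \<in> S"
    and X: "tangent_field S TS X" and Y: "tangent_field S TS Y"
  shows "cov \<Gamma> X Y P \<in> TS P"
    and "cov \<Gamma> X Y P - cov \<Gamma> Y X P =
      frechet_derivative Y (at P) (X P) - frechet_derivative X (at P) (Y P)"
    and "tangent_field S TS Z \<Longrightarrow> frechet_derivative (\<lambda>Q. h Q (Y Q) (Z Q)) (at P) (X P) =
      h P (cov \<Gamma> X Y P) (Z P) + h P (Y P) (cov \<Gamma> X Z P)"
proof -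
  note * = \<Gamma>[unfolded is_levi_civita_def]
  show "cov \<Gamma> X Y P \<in> TS P"
    using *[THEN conjunct2, THEN conjunct1] X Y P by simp
  show "cov \<Gamma> X Y P - cov \<Gamma> Y X P =
      frechet_derivative Y (at P) (X P) - frechet_derivative X (at P) (Y P)"
    using *[THEN conjunct2, THEN conjunct2, THEN conjunct1] X Y P by simp
  show "frechet_derivative (\<lambda>Q. h Q (Y Q) (Z Q)) (at P) (X P) =
      h P (cov \<Gamma> X Y P) (Z P) + h P (Y P) (cov \<Gamma> X Z P)" if "tangent_field S TS Z"
    using *[THEN conjunct2, THEN conjunct2, THEN conjunct2] X Y that P by simp
qed

text \<open>The ambient derivatives cancel in the difference of two connections, leaving a tensor
  \<Delta>. Equal torsion makes it symmetric in its two arguments, and metric compatibility makes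
  \<open>gbar P (\<Delta> u v) w\<close> skew in v and w. Alternating these symmetries returns to
  the starting term after three sign changes, so it vanishes for all w, and nondegeneracy
  applies.\<close>

lemma levi_civita_SN_unique:
  fixes P :: "real^'n::finite^'n"
  assumes \<Gamma>: "is_levi_civita (SN \<kappa>) tangent_SN gbar \<Gamma>" and P: "P \<in> SN \<kappa>"
    and u: "u \<in> tangent_SN P" and v: "v \<in> tangent_SN P"
  shows "\<Gamma> P u v = christoffel_SN P u v"
proof -
  define \<Delta> where "\<Delta> = (\<lambda>u v. \<Gamma> P u v - christoffel_SN P u v)"
  note \<Gamma>' = is_levi_civita_christoffel_SN[of \<kappa>]
  have cov_diff: "cov \<Gamma> X Y P - cov christoffel_SN X Y P = \<Delta> (X P) (Y P)" for X Y
    by (simp add: cov_def \<Delta>_def)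
  have tangent: "\<Delta> u v \<in> tangent_SN P" and sym: "\<Delta> u v = \<Delta> v u"
    if u: "u \<in> tangent_SN P" and v: "v \<in> tangent_SN P" for u v
  proof -
    obtain X Y where X: "tangent_field (SN \<kappa>) tangent_SN X" "X P = u"
      and Y: "tangent_field (SN \<kappa>) tangent_SN Y" "Y P = v"
      by (metis tangent_SN_extend[OF P u] tangent_SN_extend[OF P v])
    show "\<Delta> u v \<in> tangent_SN P"
      using tangent_SN_diff[OF is_levi_civitaD(1)[OF \<Gamma> P X(1) Y(1)] is_levi_civitaD(1)[OF \<Gamma>' P X(1) Y(1)]]
      by (simp add: cov_diff X Y)
    have "cov \<Gamma> X Y P - cov \<Gamma> Y X P = cov christoffel_SN X Y P - cov christoffel_SN Y X P"
      using is_levi_civitaD(2)[OF \<Gamma> P X(1) Y(1)] is_levi_civitaD(2)[OF \<Gamma>' P X(1) Y(1)] by simp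
    then show "\<Delta> u v = \<Delta> v u"
      using cov_diff[of X Y] cov_diff[of Y X] X Y by (simp add: algebra_simps)
  qed
  have skew: "gbar P (\<Delta> u v) w = - gbar P (\<Delta> u w) v"
    if u: "u \<in> tangent_SN P" and v: "v \<in> tangent_SN P" and w: "w \<in> tangent_SN P" for u v w
  proof -
    obtain X Y Z where X: "tangent_field (SN \<kappa>) tangent_SN X" "X P = u"
      and Y: "tangent_field (SN \<kappa>) tangent_SN Y" "Y P = v"
      and Z: "tangent_field (SN \<kappa>) tangent_SN Z" "Z P = w"
      by (metis tangent_SN_extend[OF P u] tangent_SN_extend[OF P v] tangent_SN_extend[OF P w])
    have "gbar P (cov \<Gamma> X Y P) w + gbar P v (cov \<Gamma> X Z P)
      = gbar P (cov christoffel_SN X Y P) w + gbar P v (cov christoffel_SN X Z P)"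
      using is_levi_civitaD(3)[OF \<Gamma> P X(1) Y(1) Z(1)] is_levi_civitaD(3)[OF \<Gamma>' P X(1) Y(1) Z(1)] Y Z
      by simp
    then have "gbar P (cov \<Gamma> X Y P - cov christoffel_SN X Y P) w
      + gbar P v (cov \<Gamma> X Z P - cov christoffel_SN X Z P) = 0"
      by (simp add: gbar_def matrix_algebra trace_sub)
    then show ?thesis
      using gbar_commute[of P v] by (simp add: cov_diff X Y Z)
  qed
  have "\<Delta> u v = 0"
  proof (rule gbar_nondegenerate[OF P tangent[OF u v]])
    fix w assume w: "w \<in> tangent_SN P"
    have "gbar P (\<Delta> u v) w = - gbar P (\<Delta> w u) v" using skew[OF u v w] sym[OF u w] by simp
    also have "\<dots> = gbar P (\<Delta> w v) u" using skew[OF w u v] by simp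
    also have "\<dots> = - gbar P (\<Delta> u v) w" using skew[OF v w u] sym[OF v w] sym[OF v u] by simp
    finally show "gbar P (\<Delta> u v) w = 0" by simp
  qed
  then show ?thesis by (simp add: \<Delta>_def)
qed

text \<open>Existence makes the chosen connection satisfy the axioms; uniqueness then gives its
  value on tangent vectors whatever the choice.\<close>

lemma levi_civita_SN:
  assumes "P \<in> SN \<kappa>" "u \<in> tangent_SN P" "v \<in> tangent_SN P"
  shows "levi_civita (SN \<kappa>) tangent_SN gbar P u v = christoffel_SN P u v"
  unfolding levi_civita_def
  by (rule levi_civita_SN_unique[OF someI[of "is_levi_civita (SN \<kappa>) tangent_SN gbar", OF is_levi_civita_christoffel_SN] assms])

section \<open>Smoothness of components and the tension field\<close>

lemma Ck_on_cong:
  assumes "open S" and "\<And>x. x \<in> S \<Longrightarrow> f x = f' x" and "Ck_on k S f"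
  shows "Ck_on k S f'"
  using assms(2,3)
proof (induction k arbitrary: f f')
  case 0
  then show ?case by (simp cong: continuous_on_cong)
next
  case (Suc k)
  have f: "(f has_derivative frechet_derivative f (at x)) (at x)" if "x \<in> S" for x
    using Suc.prems(2) that by (simp add: frechet_derivative_works[symmetric])
  have f': "(f' has_derivative frechet_derivative f (at x)) (at x)" if "x \<in> S" for x
    by (rule has_derivative_transform_within_open[OF f[OF that] assms(1) that Suc.prems(1)])
  have "Ck_on k S (\<lambda>x. frechet_derivative f' (at x) v)" for v
    by (rule Suc.IH[of "\<lambda>x. frechet_derivative f (at x) v"])
      (use f' Suc.prems(2) frechet_derivative_at in \<open>force+\<close>)
  with f' show ?case by (auto intro: differentiableI)
qed

text \<open>Restricting to the slice x -> (x, 0) recovers f, and the derivative of the lifted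
  function in direction (v, 0) is again a lifted function, namely that of the derivative of f along
  v. Hence the induction on k.\<close>

lemma Ck_on_fst_cancel:
  fixes f :: "'v::euclidean_space \<Rightarrow> 'w::real_normed_vector"
  assumes S: "open S" and f: "Ck_on k (S \<times> (UNIV :: 'u::euclidean_space set)) (\<lambda>q. f (fst q))"
  shows "Ck_on k S f"
  using f
proof (induction k arbitrary: f)
  case 0
  then have "continuous_on ((\<lambda>x. (x, 0::'u)) ` S) (\<lambda>q. f (fst q))"
    by (auto elim: continuous_on_subset)
  then have "continuous_on S ((\<lambda>q. f (fst q)) \<circ> (\<lambda>x. (x, 0::'u)))"
    by (intro continuous_on_compose continuous_intros)
  then show ?case by (simp add: o_def)
next
  case (Suc k)
  have deriv: "(f has_derivative frechet_derivative f (at x)) (at x)" if "x \<in> S" for x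
  proof -
    have "(\<lambda>q. f (fst q)) differentiable (at (x, 0::'u))"
      using Suc.prems that by simp
    then have "((\<lambda>q. f (fst q)) \<circ> (\<lambda>x. (x, 0::'u))) differentiable (at x)"
      by (intro differentiable_chain_at differentiable_Pair) simp_all
    then show ?thesis by (simp add: o_def frechet_derivative_works[symmetric])
  qed
  have "Ck_on k S (\<lambda>x. frechet_derivative f (at x) v)" for v
  proof (rule Suc.IH)
    have eq: "frechet_derivative (\<lambda>q. f (fst q)) (at q) (v, 0) = frechet_derivative f (at (fst q)) v"
      if "q \<in> S \<times> (UNIV :: 'u set)" for q
    proof -
      have "((\<lambda>q. f (fst q)) has_derivative (\<lambda>w. frechet_derivative f (at (fst q)) (fst w))) (at q)"
        using that by (intro has_derivative_compose[of fst fst, OF _ deriv] has_derivative_fst has_derivative_ident) auto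
      from frechet_derivative_at[OF this, symmetric] show ?thesis by simp
    qed
    have "Ck_on k (S \<times> (UNIV :: 'u set)) (\<lambda>q. frechet_derivative (\<lambda>q. f (fst q)) (at q) (v, 0))"
      using Suc.prems by (simp only: Ck_on.simps)
    from Ck_on_cong[OF open_Times[OF S open_UNIV] eq this]
    show "Ck_on k (S \<times> (UNIV :: 'u set)) (\<lambda>q. frechet_derivative f (at (fst q)) v)" .
  qed
  with deriv show ?case by (auto intro: differentiableI)
qed

section \<open>Derivatives of matrix-valued maps and the tension field\<close>

lemma pd_entry:
  fixes F :: "real^'n::finite \<Rightarrow> real^'k::finite^'l::finite"
  assumes "F differentiable (at p)"
  shows "pd \<alpha> F p $ i $ j = pd \<alpha> (\<lambda>q. F q $ i $ j) p"
proof -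
  have "((\<lambda>q. F q $ i $ j) has_derivative (\<lambda>v. frechet_derivative F (at p) v $ i $ j)) (at p)"
    using assms by (intro has_derivative_compose[OF _ has_derivative_entry])
      (simp add: frechet_derivative_works[symmetric])
  from frechet_derivative_at[OF this, symmetric] show ?thesis by (simp add: pd_def)
qed

context
  fixes S :: "(real^'n::finite) set" and F :: "real^'n \<Rightarrow> real^'k::finite^'l::finite"
  assumes S: "open S" and C2: "\<And>i j. Ck_on 2 S (\<lambda>q. F q $ i $ j)"
begin

lemma C2_differentiable:
  assumes "q \<in> S"
  shows "F differentiable (at q)"
  using C2 assms by (intro differentiable_entrywise) (simp add: numeral_2_eq_2)

text \<open>Reconciles the second derivatives of a matrix-valued map in \<open>map_hessian\<close>
  with those of its scalar entries in \<open>laplacian\<close>.\<close>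

lemma pd_pd_entry:
  assumes "p \<in> S"
  shows "pd \<alpha> (pd \<beta> F) p $ i $ j = pd \<alpha> (pd \<beta> (\<lambda>q. F q $ i $ j)) p"
proof -
  have eq: "pd \<beta> (\<lambda>q. F q $ i $ j) q = pd \<beta> F q $ i $ j" if "q \<in> S" for q i j
    by (simp add: pd_entry[OF C2_differentiable[OF that]])
  have d: "pd \<beta> (\<lambda>q. F q $ i $ j) differentiable (at p)" for i j
    using C2 assms by (simp add: numeral_2_eq_2 pd_def[abs_def])
  have "((\<lambda>q. pd \<beta> F q $ i $ j) has_derivative
      frechet_derivative (pd \<beta> (\<lambda>q. F q $ i $ j)) (at p)) (at p)" for i j
    by (rule has_derivative_transform_within_open[OF _ S assms eq])
      (simp add: d frechet_derivative_works[symmetric])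
  note this[THEN frechet_derivative_at] and this[THEN differentiableI]
  then show ?thesis
    by (subst pd_entry[OF differentiable_entrywise]) (auto simp: pd_def[of \<alpha>])
qed

end

text \<open>Both constraints are constant along F on an open set; for the determinant, Jacobi's
  formula turns this into the trace condition after division by det(F p).\<close>

lemma pd_tangent_SN:
  fixes F :: "real^'n::finite \<Rightarrow> real^'r::finite^'r"
  assumes S: "open S" "p \<in> S" and F: "F differentiable (at p)" and SN: "\<And>q. q \<in> S \<Longrightarrow> F q \<in> SN \<kappa>"
  shows "pd \<alpha> F p \<in> tangent_SN (F p)"
proof -
  let ?D = "frechet_derivative F (at p)"
  have D: "(F has_derivative ?D) (at p)" using F by (simp add: frechet_derivative_works)
  have P: "F p \<in> SN \<kappa>" using S SN by blast
  have "((\<lambda>q. transpose (F q) - F q) has_derivative (\<lambda>v. transpose (?D v) - ?D v)) (at p)"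
    by (intro has_derivative_diff bounded_linear.has_derivative[OF bounded_linear_transpose] D)
  moreover have "((\<lambda>q. transpose (F q) - F q) has_derivative (\<lambda>_. 0)) (at p)"
    by (rule has_derivative_transform_within_open[OF has_derivative_const S]) (simp add: SN_sym[OF SN])
  ultimately have "(\<lambda>v. transpose (?D v) - ?D v) = (\<lambda>_. 0)" by (rule has_derivative_unique)
  then have "transpose (?D v) = ?D v" for v by (meson eq_iff_diff_eq_0)
  moreover have "((\<lambda>q. det (F q)) has_derivative (\<lambda>v. det (F p) * trace (matrix_inv (F p) ** ?D v))) (at p)"
    by (rule has_derivative_compose[OF D has_derivative_det[OF SN_invertible[OF P]]])
  moreover have "((\<lambda>q. det (F q)) has_derivative (\<lambda>_. 0)) (at p)"
    by (rule has_derivative_transform_within_open[OF has_derivative_const S]) (simp add: SN_det[OF SN])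
  ultimately have "(\<lambda>v. det (F p) * trace (matrix_inv (F p) ** ?D v)) = (\<lambda>_. 0)"
    using has_derivative_unique by blast
  then have "det (F p) * trace (matrix_inv (F p) ** ?D v) = 0" for v by meson
  then have "trace (matrix_inv (F p) ** ?D v) = 0" for v
    using SN_invertible[OF P] by (simp add: invertible_det_nz)
  with \<open>\<And>v. transpose (?D v) = ?D v\<close> show ?thesis by (simp add: pd_def tangent_SN_def)
qed

lemma tension_SN:
  fixes F :: "real^'n::finite \<Rightarrow> real^'r::finite^'r" and g :: "real^'n \<Rightarrow> real^'n^'n"
  assumes S: "open S" "p \<in> S" and C2: "\<And>i j. Ck_on 2 S (\<lambda>q. F q $ i $ j)"
    and SN: "\<And>q. q \<in> S \<Longrightarrow> F q \<in> SN \<kappa>"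
    and g: "transpose (matrix_inv (g p)) = matrix_inv (g p)"
  shows "tension g (SN \<kappa>) tangent_SN gbar F p $ i $ j = laplacian g (\<lambda>q. F q $ i $ j) p
     - (\<Sum>k\<in>UNIV. \<Sum>l\<in>UNIV. \<Sum>\<alpha>\<in>UNIV. \<Sum>\<beta>\<in>UNIV.
         matrix_inv (F p) $ k $ l * matrix_inv (g p) $ \<alpha> $ \<beta> *
         pd \<alpha> (\<lambda>q. F q $ i $ k) p * pd \<beta> (\<lambda>q. F q $ l $ j) p)"
proof -
  let ?g = "\<lambda>\<alpha> \<beta>. matrix_inv (g p) $ \<alpha> $ \<beta>"
  define Q where "Q = (\<lambda>\<alpha> \<beta>. (pd \<alpha> F p ** matrix_inv (F p) ** pd \<beta> F p) $ i $ j)"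
  note diff = C2_differentiable[OF S(1) C2 S(2)]
  have "levi_civita (SN \<kappa>) tangent_SN gbar (F p) (pd \<alpha> F p) (pd \<beta> F p)
      = christoffel_SN (F p) (pd \<alpha> F p) (pd \<beta> F p)" for \<alpha> \<beta>
    by (rule levi_civita_SN[OF SN[OF S(2)] pd_tangent_SN[OF S diff SN] pd_tangent_SN[OF S diff SN]])
  then have "map_hessian g (SN \<kappa>) tangent_SN gbar F \<alpha> \<beta> p $ i $ j
      = pd \<alpha> (pd \<beta> (\<lambda>q. F q $ i $ j)) p - (\<Sum>\<gamma>\<in>UNIV. christoffel g \<gamma> \<alpha> \<beta> p * pd \<gamma> (\<lambda>q. F q $ i $ j) p)
        - 1/2 * (Q \<alpha> \<beta> + Q \<beta> \<alpha>)" for \<alpha> \<beta>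
    by (simp add: map_hessian_def christoffel_SN_def Q_def pd_pd_entry[OF S(1) C2 S(2)] pd_entry[OF diff])
  then have tension: "tension g (SN \<kappa>) tangent_SN gbar F p $ i $ j = laplacian g (\<lambda>q. F q $ i $ j) p
      - (\<Sum>\<alpha>\<in>UNIV. \<Sum>\<beta>\<in>UNIV. ?g \<alpha> \<beta> * (1/2 * (Q \<alpha> \<beta> + Q \<beta> \<alpha>)))"
    by (simp add: tension_def laplacian_def right_diff_distrib sum_subtractf)
  have "?g \<beta> \<alpha> = ?g \<alpha> \<beta>" for \<alpha> \<beta>
    using arg_cong[OF g, of "\<lambda>M. M $ \<alpha> $ \<beta>"] by (simp add: transpose_def)
  \<comment> \<open>Symmetry of the inverse metric allows relabelling, so the two halves of the
    symmetrized product contribute equally and the factor 1/2 disappears.\<close>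
  then have "(\<Sum>\<alpha>\<in>UNIV. \<Sum>\<beta>\<in>UNIV. ?g \<alpha> \<beta> * Q \<beta> \<alpha>) = (\<Sum>\<alpha>\<in>UNIV. \<Sum>\<beta>\<in>UNIV. ?g \<alpha> \<beta> * Q \<alpha> \<beta>)"
    by (subst sum.swap) simp
  then have "(\<Sum>\<alpha>\<in>UNIV. \<Sum>\<beta>\<in>UNIV. ?g \<alpha> \<beta> * (1/2 * (Q \<alpha> \<beta> + Q \<beta> \<alpha>)))
      = (\<Sum>\<alpha>\<in>UNIV. \<Sum>\<beta>\<in>UNIV. ?g \<alpha> \<beta> * Q \<alpha> \<beta>)"
    by (simp add: distrib_left sum.distrib add_divide_distrib flip: sum_divide_distrib)
  also have "\<dots> = (\<Sum>\<alpha>\<in>UNIV. \<Sum>\<beta>\<in>UNIV. \<Sum>l\<in>UNIV. \<Sum>k\<in>UNIV.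
         matrix_inv (F p) $ k $ l * ?g \<alpha> \<beta> * pd \<alpha> (\<lambda>q. F q $ i $ k) p * pd \<beta> (\<lambda>q. F q $ l $ j) p)"
    by (simp add: Q_def matrix_matrix_mult_def sum_distrib_left sum_distrib_right pd_entry[OF diff] mult_ac)
  also have "\<dots> = (\<Sum>l\<in>UNIV. \<Sum>k\<in>UNIV. \<Sum>\<alpha>\<in>UNIV. \<Sum>\<beta>\<in>UNIV.
         matrix_inv (F p) $ k $ l * ?g \<alpha> \<beta> * pd \<alpha> (\<lambda>q. F q $ i $ k) p * pd \<beta> (\<lambda>q. F q $ l $ j) p)"
    \<comment> \<open>The types restrict the rewriting to exchanging a base sum with a fibre sum in
      one fixed direction, so it terminates.\<close>
    by (simp only: sum.swap[of _ "UNIV::'n set" "UNIV::'r set"])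
  also have "\<dots> = (\<Sum>k\<in>UNIV. \<Sum>l\<in>UNIV. \<Sum>\<alpha>\<in>UNIV. \<Sum>\<beta>\<in>UNIV.
         matrix_inv (F p) $ k $ l * ?g \<alpha> \<beta> * pd \<alpha> (\<lambda>q. F q $ i $ k) p * pd \<beta> (\<lambda>q. F q $ l $ j) p)"
    by (rule sum.swap)
  finally show ?thesis using tension by simp
qed

section \<open>Reading off the components of an invariant metric\<close>

lemma axis_inner_matrix:
  fixes M :: "real^'n::finite^'m::finite"
  shows "axis i 1 \<bullet> (M *v axis j 1) = M $ i $ j"
  by (simp add: matrix_vector_mult_basis inner_axis' column_def)

lemma riemannian_metricD:
  assumes h: "riemannian_metric \<A> h" and chart: "(V, \<phi>) \<in> charts \<A>"
  shows "m \<in> V \<Longrightarrow> h (V, \<phi>) m x y = h (V, \<phi>) m y x"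
    and "m \<in> V \<Longrightarrow> x \<noteq> 0 \<Longrightarrow> h (V, \<phi>) m x x > 0"
    and "smooth_on (\<phi> ` V) (\<lambda>q. h (V, \<phi>) (inv_into V \<phi> q) x y)"
proof -
  note * = h[unfolded riemannian_metric_def, THEN conjunct1, THEN bspec, OF chart, unfolded prod.case]
  show "h (V, \<phi>) m x y = h (V, \<phi>) m y x" if "m \<in> V"
    using *[THEN conjunct1, THEN bspec, OF that] by blast
  show "h (V, \<phi>) m x x > 0" if "m \<in> V" "x \<noteq> 0"
    using *[THEN conjunct1, THEN bspec, OF that(1)] that(2) by blast
  show "smooth_on (\<phi> ` V) (\<lambda>q. h (V, \<phi>) (inv_into V \<phi> q) x y)"
    using *[THEN conjunct2] by blast
qed

text \<open>On the horizontal vectors (u, -A u) the fibre term vanishes, so g inherits positivity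
  and symmetry from the metric of the total space.\<close>

lemma components_base_metric:
  fixes B :: "('b::topological_space, 'm::topological_space, 'e::topological_space, 'n::finite, 'r::finite) tp_bundle"
  assumes h: "riemannian_metric (total_atlas B) h" and comp: "has_components B h (U, \<beta>, \<xi>) g A G"
    and chart: "(U, \<beta>, \<xi>) \<in> fiber_charts B" and p: "p \<in> \<beta> ` U"
  shows "invertible (g p)" "transpose (g p) = g p"
proof -
  define V where "V = proj B -` U"
  define \<phi> where "\<phi> = (\<lambda>m. (\<beta> (proj B m), \<xi> m))"
  have tc: "total_chart B (U, \<beta>, \<xi>) = (V, \<phi>)"
    by (simp add: total_chart_def V_def \<phi>_def)
  have charts: "(V, \<phi>) \<in> charts (total_atlas B)" and img: "\<phi> ` V = (\<beta> ` U) \<times> UNIV"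
    using chart tc by (auto simp: fiber_charts_def V_def \<phi>_def)
  have "(p, 0) \<in> \<phi> ` V" using p img by simp
  then obtain m where m: "m \<in> V" "\<beta> (proj B m) = p" by (auto simp: \<phi>_def)
  have eq: "h (V, \<phi>) m (u, - (A p *v u)) (v, - (A p *v v)) = u \<bullet> (g p *v v)" for u v
    using comp m by (simp add: has_components_def tc V_def Let_def)
  note sym = riemannian_metricD(1)[OF h charts m(1)] and pos = riemannian_metricD(2)[OF h charts m(1)]
  show "invertible (g p)"
  proof (rule invertible_if_posdef)
    fix u :: "real^'n" assume "u \<noteq> 0"
    then have "(u, - (A p *v u)) \<noteq> 0" by (simp add: zero_prod_def)
    from pos[OF this] show "u \<bullet> (g p *v u) > 0" by (simp add: eq)
  qed
  have "u \<bullet> (g p *v v) = v \<bullet> (g p *v u)" for u v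
    using sym[of "(u, - (A p *v u))" "(v, - (A p *v v))"] by (simp add: eq)
  from this[of "axis _ 1" "axis _ 1"] show "transpose (g p) = g p"
    by (simp add: axis_inner_matrix transpose_def vec_eq_iff)
qed

text \<open>On the vertical unit vectors the metric takes the value G_ij. This is smooth in the
  total coordinates and depends only on the base part, so smoothness descends to the base.\<close>

lemma components_fiber_metric_smooth:
  fixes B :: "('b::topological_space, 'm::topological_space, 'e::topological_space, 'n::finite, 'r::finite) tp_bundle"
  assumes h: "riemannian_metric (total_atlas B) h" and comp: "has_components B h (U, \<beta>, \<xi>) g A G"
    and chart: "(U, \<beta>, \<xi>) \<in> fiber_charts B"
  shows "smooth_on (\<beta> ` U) (\<lambda>q. G q $ i $ j)"
  unfolding smooth_on_def
proof
  fix k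
  define V where "V = proj B -` U"
  define \<phi> where "\<phi> = (\<lambda>m. (\<beta> (proj B m), \<xi> m))"
  have tc: "total_chart B (U, \<beta>, \<xi>) = (V, \<phi>)"
    by (simp add: total_chart_def V_def \<phi>_def)
  have charts: "(V, \<phi>) \<in> charts (total_atlas B)" and img: "\<phi> ` V = (\<beta> ` U) \<times> UNIV"
    and "open (\<beta> ` U)"
    using chart tc by (auto simp: fiber_charts_def V_def \<phi>_def charts_def is_chart_def)
  have smooth: "Ck_on k (\<phi> ` V) (\<lambda>q. h (V, \<phi>) (inv_into V \<phi> q) (0, axis i 1) (0, axis j 1))"
    using riemannian_metricD(3)[OF h charts] by (simp add: smooth_on_def)
  have eq: "h (V, \<phi>) (inv_into V \<phi> q) (0, axis i 1) (0, axis j 1) = G (fst q) $ i $ j"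
    if q: "q \<in> \<phi> ` V" for q
  proof -
    define m where "m = inv_into V \<phi> q"
    have "m \<in> V" "\<phi> m = q"
      using inv_into_into[OF q] f_inv_into_f[OF q] by (simp_all add: m_def)
    then have m: "proj B m \<in> U" "\<beta> (proj B m) = fst q"
      by (auto simp: V_def \<phi>_def)
    show ?thesis
      using comp m unfolding m_def[symmetric]
      by (simp add: has_components_def tc axis_inner_matrix Let_def)
  qed
  have "open (\<phi> ` V)"
    unfolding img by (rule open_Times[OF \<open>open (\<beta> ` U)\<close> open_UNIV])
  from Ck_on_cong[OF this eq smooth]
  have "Ck_on k ((\<beta> ` U) \<times> (UNIV :: (real^'r) set)) (\<lambda>q. G (fst q) $ i $ j)"
    by (simp add: img)
  then show "Ck_on k (\<beta> ` U) (\<lambda>q. G q $ i $ j)"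
    by (rule Ck_on_fst_cancel[OF \<open>open (\<beta> ` U)\<close>])
qed

theorem proposition2p5:
  fixes B :: "('b::{t2_space, second_countable_topology}, 'm::{t2_space, second_countable_topology},
               'e::topological_space, 'n::finite, 'r::finite) tp_bundle"
    and T :: "real set"
    and h :: "real \<Rightarrow> ('m, (real ^ 'n) \<times> (real ^ 'r)) chart_metric"
    and g :: "('b, 'm, 'n, 'r) fchart \<Rightarrow> real \<Rightarrow> real ^ 'n \<Rightarrow> real ^ 'n ^ 'n"
    and A :: "('b, 'm, 'n, 'r) fchart \<Rightarrow> real \<Rightarrow> real ^ 'n \<Rightarrow> real ^ 'n ^ 'r"
    and G :: "('b, 'm, 'n, 'r) fchart \<Rightarrow> real \<Rightarrow> real ^ 'n \<Rightarrow> real ^ 'r ^ 'r"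
    and U :: "'b set" and \<beta> :: "'b \<Rightarrow> real ^ 'n" and \<xi> :: "'m \<Rightarrow> real ^ 'r"
    and c :: "('b, 'm, 'n, 'r) fchart"
    and t \<kappa> :: real and p :: "real ^ 'n" and i j :: 'r
  assumes "twisted_principal_bundle B"
    and "compact (UNIV :: 'b set)"
    and "invariant_ricci_flow B T h g A G"
    and "c = (U, \<beta>, \<xi>)" and "c \<in> adapted_charts B"
    and "t \<in> T"
    and "\<forall>q\<in>\<beta> ` U. G c t q \<in> SN \<kappa>"
    and "p \<in> \<beta> ` U"
  shows "((\<lambda>s. G c s p $ i $ j) has_real_derivative
            tension (g c t) (SN \<kappa>) tangent_SN gbar (G c t) p $ i $ j
            - 1/2 * curv_term (g c t) (A c t) (G c t) i j p) (at t within T)"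
proof -
  have chart: "(U, \<beta>, \<xi>) \<in> fiber_charts B"
    using assms(4,5) by (auto simp: adapted_charts_def)
  then have "open (\<beta> ` U)"
    by (auto simp: fiber_charts_def charts_def is_chart_def)
  note flow = assms(3)[unfolded invariant_ricci_flow_def, THEN conjunct2, THEN conjunct2]
  note flow_chart = flow[THEN conjunct2, THEN bspec, OF assms(5)[unfolded assms(4)], unfolded prod.case,
      THEN bspec, OF assms(6), folded assms(4)]
  have metric: "riemannian_metric (total_atlas B) (h t)"
    using flow[THEN conjunct1, THEN bspec, OF assms(6)] by (simp add: locally_invariant_metric_def)
  have comp: "has_components B (h t) (U, \<beta>, \<xi>) (g c t) (A c t) (G c t)"
    using flow_chart[THEN conjunct1] by (simp add: assms(4))
  have deriv: "((\<lambda>s. G c s p $ i $ j) has_real_derivative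
      flow_rhs_G (g c t) (A c t) (G c t) i j p) (at t within T)"
    using flow_chart[THEN conjunct2, THEN bspec, OF assms(8)] by blast
  note g = components_base_metric[OF metric comp chart assms(8)]
  have C2: "Ck_on 2 (\<beta> ` U) (\<lambda>q. G c t q $ k $ l)" for k l
    using components_fiber_metric_smooth[OF metric comp chart] by (simp add: smooth_on_def)
  have SN: "G c t q \<in> SN \<kappa>" if "q \<in> \<beta> ` U" for q
    using assms(7) that by blast
  have inv: "transpose (matrix_inv (g c t p)) = matrix_inv (g c t p)"
    by (simp add: transpose_matrix_inv g)
  \<comment> \<open>The Laplacian and gradient terms of the flow make up the tension field; the
    curvature term is the same on both sides.\<close>
  have "tension (g c t) (SN \<kappa>) tangent_SN gbar (G c t) p $ i $ j
      - 1/2 * curv_term (g c t) (A c t) (G c t) i j p = flow_rhs_G (g c t) (A c t) (G c t) i j p"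
    by (simp only: flow_rhs_G_def
        tension_SN[where F = "G c t" and g = "g c t", OF \<open>open (\<beta> ` U)\<close> assms(8) C2 SN inv])
  with deriv show ?thesis by (simp only:)
qed

end
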